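(* Let $(g_n)_{n=1}^\infty$ be a seminormalized, right dominant Schauder basis (of some Banach space) and let $X$ be a Banach space. If every normalized, weakly null sequence in $X$ has a subsequence dominated by a subsequence of $(g_n)_{n=1}^\infty$, then there exists $C>0$ such that every normalized, weakly null sequence in $X$ admits a subsequence $C$-dominated by a subsequence of $(g_n)_{n=1}^\infty$.
   Context: Domination: for sequences $(e_n)_{n=1}^\infty$, $(f_n)_{n=1}^\infty$ in possibly different Banach spaces, $(f_n)$ $C$-dominates $(e_n)$ (equivalently, $(e_n)$ is $C$-dominated by $(f_n)$) if $\|\sum_n a_n e_n\|\leqslant C\|\sum_n a_n f_n\|$ for every finitely supported scalar sequence $(a_n)_{n=1}^\infty$; $(f_n)$ dominates $(e_n)$ if it $C$-dominates it for some $C$. Right dominance: a Schauder basis $(g_n)_{n=1}^\infty$ is right dominant if for any sequences $m_1<m_2<\ldots$ and $l_1<l_2<\ldots$ of positive integers with $m_n\leqslant l_n$ for all $n\in\mathbb{N}$, $(g_{m_n})_{n=1}^\infty$ is dominated by $(g_{l_n})_{n=1}^\infty$. *)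

theory Defs
  imports "HOL-Analysis.Analysis"
begin

text \<open>
  The scalar field is a type of class \<open>real_normed_field\<close> (in which the norm is multiplicative), so
  by the Gelfand--Mazur theorem it is \<open>real\<close> or \<open>complex\<close> up to isometric isomorphism. The class
  \<open>euclidean_space\<close>, of which both are instances, makes local compactness available.

  A Banach space over such a field is a type of class \<open>banach\<close>, which is complete and carries
  the norm, together with a scalar multiplication extending \<open>scaleR\<close>.
\<close>

locale normed_space_over = vector_space smul
  for smul :: "'k::{real_normed_field,euclidean_space} \<Rightarrow> 'a::real_normed_vector \<Rightarrow> 'a" +
  assumes norm_scale: "norm (smul c x) = norm c * norm x"
    and scale_of_real: "smul (of_real r) x = r *\<^sub>R x"

text \<open>Sequences are indexed by \<open>nat\<close> starting from 0, a shift of the positive integers.\<close>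

definition C_dominates ::
  "real \<Rightarrow> ('k::{real_normed_field,euclidean_space} \<Rightarrow> 'b::real_normed_vector \<Rightarrow> 'b) \<Rightarrow> (nat \<Rightarrow> 'b) \<Rightarrow>
    ('k \<Rightarrow> 'a::real_normed_vector \<Rightarrow> 'a) \<Rightarrow> (nat \<Rightarrow> 'a) \<Rightarrow> bool"
  where "C_dominates C smul_f f smul_e e \<longleftrightarrow>
    (\<forall>a :: nat \<Rightarrow> 'k. finite {n. a n \<noteq> 0} \<longrightarrow>
      norm (\<Sum>n | a n \<noteq> 0. smul_e (a n) (e n)) \<le> C * norm (\<Sum>n | a n \<noteq> 0. smul_f (a n) (f n)))"

definition dominates ::
  "('k::{real_normed_field,euclidean_space} \<Rightarrow> 'b::real_normed_vector \<Rightarrow> 'b) \<Rightarrow> (nat \<Rightarrow> 'b) \<Rightarrow>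
    ('k \<Rightarrow> 'a::real_normed_vector \<Rightarrow> 'a) \<Rightarrow> (nat \<Rightarrow> 'a) \<Rightarrow> bool"
  where "dominates smul_f f smul_e e \<longleftrightarrow> (\<exists>C. C_dominates C smul_f f smul_e e)"

definition schauder_basis ::
  "('k::{real_normed_field,euclidean_space} \<Rightarrow> 'b::real_normed_vector \<Rightarrow> 'b) \<Rightarrow> (nat \<Rightarrow> 'b) \<Rightarrow> bool"
  where "schauder_basis smul g \<longleftrightarrow>
    (\<forall>x. \<exists>!a :: nat \<Rightarrow> 'k. (\<lambda>n. smul (a n) (g n)) sums x)"

definition seminormalized :: "(nat \<Rightarrow> 'b::real_normed_vector) \<Rightarrow> bool"
  where "seminormalized g \<longleftrightarrow> (\<exists>c>0. \<exists>D. \<forall>n. c \<le> norm (g n) \<and> norm (g n) \<le> D)"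

definition right_dominant ::
  "('k::{real_normed_field,euclidean_space} \<Rightarrow> 'b::real_normed_vector \<Rightarrow> 'b) \<Rightarrow> (nat \<Rightarrow> 'b) \<Rightarrow> bool"
  where "right_dominant smul g \<longleftrightarrow>
    (\<forall>m l :: nat \<Rightarrow> nat. strict_mono m \<and> strict_mono l \<and> (\<forall>n. m n \<le> l n) \<longrightarrow>
      dominates smul (g \<circ> l) smul (g \<circ> m))"

definition normalized :: "(nat \<Rightarrow> 'a::real_normed_vector) \<Rightarrow> bool"
  where "normalized x \<longleftrightarrow> (\<forall>n. norm (x n) = 1)"

text \<open>\<open>bounded_linear\<close> only gives linearity over \<open>real\<close>, whence the separate homogeneity condition.\<close>

definition weakly_null ::
  "('k::{real_normed_field,euclidean_space} \<Rightarrow> 'a::real_normed_vector \<Rightarrow> 'a) \<Rightarrow> (nat \<Rightarrow> 'a) \<Rightarrow> bool"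
  where "weakly_null smul x \<longleftrightarrow>
    (\<forall>\<phi> :: 'a \<Rightarrow> 'k. bounded_linear \<phi> \<and> (\<forall>c v. \<phi> (smul c v) = c * \<phi> v) \<longrightarrow>
      (\<lambda>n. \<phi> (x n)) \<longlonglongrightarrow> 0)"

end

theory Submission
  imports Defs
begin

text \<open>
  Suppose that no constant works. Then for every \<open>n\<close> there is a normalized weakly null sequence, the
  \<open>n\<close>-th row \<open>x n\<close>, none of whose subsequences is \<open>4 ^ n\<close>-dominated by a subsequence of \<open>g\<close>. The
  sequence \<open>z k\<close> of sums over \<open>j \<le> k\<close> of \<open>(1/2) ^ j\<close> times a late element of the \<open>j\<close>-th row is bounded
  and weakly null. It ought to inherit a failure of order \<open>4 ^ n / 2 ^ n\<close> from every row, so that no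
  subsequence of it is dominated by a subsequence of \<open>g\<close>, contrary to hypothesis. The danger is that the
  rows cancel each other; the point of the proof is to choose the elements of the rows so that
  they cannot.

  Along every increasing sequence \<open>p\<close> of indices the badness of a row is witnessed by a finite prefix
  of \<open>p\<close>, by coefficients on it, and by a functional norming the resulting combination. These
  functionals are fixed once and for all, one for each row and each minimal witnessing prefix.
  Weak nullness and compactness of the dual ball show that any finite number of functionals are
  simultaneously small at some element of every sufficiently long finite window of indices
  (\<open>finite_window\<close>). The Nash-Williams dichotomy turns some element into all elements: in a
  suitable infinite set \<open>N\<close> of indices, each of the functionals is summably small at every element
  of \<open>N\<close> that falls into a gap of its prefix (\<open>separated_functionals\<close>). If the rows use interleaving
  elements of \<open>N\<close>, then the functional of a witness for one row hardly sees the other rows, and the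
  failure of the row passes to \<open>z\<close> (\<open>diagonal_sum_estimate\<close>). The error terms are bounded by the
  coefficients of the witness, which the basis controls (\<open>schauder_coefficients_bounded\<close>).

  Right dominance serves to compare the failure of domination, formulated with the basis vectors at
  the indices of the witness shifted by one, with an arbitrary subsequence of \<open>g\<close> assumed to dominate
  a subsequence of \<open>z\<close>. As the witnesses vary with the row, a constant independent of the sequences
  is needed (\<open>uniform_right_dominance\<close>).
\<close>

section \<open>The Nash-Williams dichotomy\<close>

lemma infinite_above:
  fixes N s :: "nat set"
  assumes "infinite N" "finite s"
  shows "infinite {k\<in>N. \<forall>i\<in>s. i < k}"
proof -
  have "N - (\<Union>i\<in>s. {..i}) \<subseteq> {k\<in>N. \<forall>i\<in>s. i < k}" by auto
  moreover have "infinite (N - (\<Union>i\<in>s. {..i}))" using assms by simp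
  ultimately show ?thesis by (meson finite_subset)
qed

text \<open>
  A property of infinite sets that can be forced for one finite set \<open>s\<close> by thinning out, and that
  survives further thinning, can be forced for all finite subsets \<open>s\<close> of a single infinite set
  simultaneously, as long as only the elements above \<open>s\<close> are asked to have it: choose the elements
  one by one and thin out after each choice for the finitely many \<open>s\<close> below the chosen element.
\<close>

lemma fusion:
  fixes D :: "nat set \<Rightarrow> nat set \<Rightarrow> bool"
  assumes inf: "infinite M"
    and ex: "\<And>s M'. finite s \<Longrightarrow> infinite M' \<Longrightarrow> M' \<subseteq> M \<Longrightarrow> \<exists>N\<subseteq>M'. infinite N \<and> D s N"
    and mono: "\<And>s N N'. D s N \<Longrightarrow> N' \<subseteq> N \<Longrightarrow> infinite N' \<Longrightarrow> D s N'"
  shows "\<exists>N\<subseteq>M. infinite N \<and> (\<forall>s\<subseteq>N. finite s \<longrightarrow> D s {k\<in>N. \<forall>i\<in>s. i < k})"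
proof -
  have ex_all: "\<exists>N\<subseteq>M'. infinite N \<and> (\<forall>s\<in>S. D s N)"
    if "finite S" "\<forall>s\<in>S. finite s" "infinite M'" "M' \<subseteq> M" for S M'
    using that
  proof (induction S rule: finite_induct)
    case empty
    then show ?case by auto
  next
    case (insert s S)
    then obtain N where N: "N \<subseteq> M'" "infinite N" "\<forall>s\<in>S. D s N" by auto
    then obtain N' where "N' \<subseteq> N" "infinite N'" "D s N'"
      using ex[of s N] insert.prems by blast
    then show ?case using N mono by (intro exI[of _ N']) blast
  qed
  define P where "P = (\<lambda>(k::nat) (n, N). n \<in> N \<and> infinite N \<and> N \<subseteq> M \<and> D {} N)"
  define Q where "Q = (\<lambda>(k::nat) (n::nat, N) (n'::nat, N').
    N' \<subseteq> N \<and> N' \<subseteq> {n<..} \<and> (\<forall>s\<subseteq>{..n}. D s N'))"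
  have "\<exists>f. \<forall>k. P k (f k) \<and> Q k (f k) (f (Suc k))"
  proof (rule dependent_nat_choice)
    obtain N where N: "N \<subseteq> M" "infinite N" "D {} N" using ex[of "{}" M] inf by auto
    then obtain n where "n \<in> N" by (metis finite.emptyI ex_in_conv)
    then show "\<exists>x. P 0 x" using N by (auto simp: P_def)
  next
    fix x k assume "P k x"
    then obtain n N where x: "x = (n, N)" "n \<in> N" "infinite N" "N \<subseteq> M" "D {} N"
      by (auto simp: P_def split: prod.splits)
    have "infinite (N \<inter> {n<..})"
      using x(3) by (metis finite_atMost Compl_atMost finite_Diff2 Diff_eq)
    then obtain N' where N': "N' \<subseteq> N \<inter> {n<..}" "infinite N'" "\<forall>s\<in>Pow {..n}. D s N'"
      using ex_all[of "Pow {..n}" "N \<inter> {n<..}"] x by (auto dest: finite_subset)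
    then obtain n' where "n' \<in> N'" by (metis finite.emptyI ex_in_conv)
    then have "P (Suc k) (n', N') \<and> Q k x (n', N')"
      using x N' by (auto simp: P_def Q_def)
    then show "\<exists>y. P (Suc k) y \<and> Q k x y" by blast
  qed
  then obtain f where f: "\<And>k. P k (f k)" "\<And>k. Q k (f k) (f (Suc k))" by blast
  define n where "n = (\<lambda>k. fst (f k))"
  define A where "A = (\<lambda>k. snd (f k))"
  have nA: "n k \<in> A k" and AM: "A k \<subseteq> M" and D0: "D {} (A k)" for k
    using f(1)[of k] by (auto simp: P_def n_def A_def split: prod.splits)
  have AS: "A (Suc k) \<subseteq> A k" "A (Suc k) \<subseteq> {n k<..}" and DS: "s \<subseteq> {..n k} \<Longrightarrow> D s (A (Suc k))"
    for k s
    using f(2)[of k] by (auto simp: Q_def n_def A_def split: prod.splits)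
  have Amono: "A l \<subseteq> A k" if "k \<le> l" for k l
    using AS(1) lift_Suc_antimono_le[of A] that by blast
  have sm: "strict_mono n"
    using nA AS(2) by (intro strict_monoI_Suc) blast
  have inf_n: "infinite (range n)" using sm strict_mono_imp_increasing
    by (metis infinite_iff_countable_subset strict_mono_imp_inj_on subset_refl)
  have "D s {k\<in>range n. \<forall>i\<in>s. i < k}" if s: "s \<subseteq> range n" "finite s" for s
  proof -
    note tail = infinite_above[OF inf_n s(2)]
    show ?thesis
    proof (cases "s = {}")
      case True
      have "range n \<subseteq> A 0" using nA Amono by blast
      then show ?thesis using True D0[of 0] mono inf_n by auto
    next
      case False
      then obtain k where k: "Max s = n k" using s Max_in by blast
      have "s \<subseteq> {..n k}" using k s(2) Max_ge by fastforce
      moreover have "{k\<in>range n. \<forall>i\<in>s. i < k} \<subseteq> A (Suc k)"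
      proof
        fix x assume x: "x \<in> {k\<in>range n. \<forall>i\<in>s. i < k}"
        then obtain l where l: "x = n l" by auto
        have "n k \<in> s" using Max_in[OF s(2) False] k by simp
        then have "n k < n l" using x l by simp
        then have "Suc k \<le> l" using sm by (simp add: strict_mono_less Suc_le_eq)
        then show "x \<in> A (Suc k)" using l nA Amono by blast
      qed
      ultimately show ?thesis using DS mono tail by blast
    qed
  qed
  moreover have "range n \<subseteq> M" using nA AM by blast
  ultimately show ?thesis using inf_n by blast
qed

text \<open>
  The dichotomy behind open Ramsey theory. A set \<open>N\<close> accepts \<open>s\<close> if every infinite continuation of
  \<open>s\<close> inside \<open>N\<close> has an initial segment in the family, and it rejects \<open>s\<close> if none of its infinite
  subsets accepts \<open>s\<close>. By fusion some \<open>N\<close> decides all of its finite subsets. If the empty set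
  is accepted, this is the second alternative. If it is rejected, then a rejected \<open>s\<close> has only
  finitely many one-point extensions that are accepted (infinitely many of them would combine to a
  set accepting \<open>s\<close>), so a second fusion yields a set rejecting all of its finite subsets, and a member
  of the family is never rejected.
\<close>

lemma nash_williams:
  fixes \<F> :: "nat set set"
  assumes "infinite M"
  shows "\<exists>N\<subseteq>M. infinite N \<and> ((\<forall>s\<subseteq>N. finite s \<longrightarrow> s \<notin> \<F>) \<or>
    (\<forall>X\<subseteq>N. infinite X \<longrightarrow> (\<exists>b. X \<inter> {..<b} \<in> \<F>)))"
proof -
  define U where "U = (\<lambda>X. \<exists>b::nat. X \<inter> {..<b} \<in> \<F>)"
  define acc where "acc = (\<lambda>N s. \<forall>X\<subseteq>N. infinite X \<and> (\<forall>i\<in>s. \<forall>k\<in>X. i < k) \<longrightarrow> U (s \<union> X))"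
  define rej where "rej = (\<lambda>N s. \<not> (\<exists>N'\<subseteq>N. infinite N' \<and> acc N' s))"
  have acc_mono: "acc N' s" if "acc N s" "N' \<subseteq> N" for N N' s
    using that unfolding acc_def by blast
  have rej_mono: "rej N' s" if "rej N s" "N' \<subseteq> N" for N N' s
    using that unfolding rej_def by blast
  have "\<exists>N\<subseteq>M. infinite N \<and> (\<forall>s\<subseteq>N. finite s \<longrightarrow>
      (acc {k\<in>N. \<forall>i\<in>s. i < k} s \<or> rej {k\<in>N. \<forall>i\<in>s. i < k} s))"
  proof (rule fusion[OF assms])
    fix s M' :: "nat set" assume "infinite M'"
    then show "\<exists>N\<subseteq>M'. infinite N \<and> (acc N s \<or> rej N s)"
      unfolding rej_def by blast
  next
    fix s N N' :: "nat set" assume "acc N s \<or> rej N s" "N' \<subseteq> N"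
    then show "acc N' s \<or> rej N' s" using acc_mono rej_mono by blast
  qed
  then obtain N where N: "N \<subseteq> M" "infinite N"
    and dec: "\<And>s. s \<subseteq> N \<Longrightarrow> finite s \<Longrightarrow>
      acc {k\<in>N. \<forall>i\<in>s. i < k} s \<or> rej {k\<in>N. \<forall>i\<in>s. i < k} s" by blast
  have decided: "acc N s" if s: "s \<subseteq> N" "finite s" "\<not> rej N s" for s
  proof -
    obtain N' where N': "N' \<subseteq> N" "infinite N'" "acc N' s" using s(3) by (auto simp: rej_def)
    have "\<not> rej {k\<in>N. \<forall>i\<in>s. i < k} s"
    proof -
      define T where "T = {k\<in>N'. \<forall>i\<in>s. i < k}"
      have "acc T s" unfolding T_def by (rule acc_mono[OF N'(3)]) blast
      moreover have "infinite T" unfolding T_def using infinite_above N'(2) s(2) by blast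
      moreover have "T \<subseteq> {k\<in>N. \<forall>i\<in>s. i < k}" unfolding T_def using N'(1) by blast
      ultimately show ?thesis unfolding rej_def by metis
    qed
    then have "acc {k\<in>N. \<forall>i\<in>s. i < k} s" using dec s by blast
    then show ?thesis unfolding acc_def by blast
  qed
  show ?thesis
  proof (cases "rej N {}")
    case False
    then have "acc N {}" using decided by blast
    then have "\<forall>X\<subseteq>N. infinite X \<longrightarrow> U X" unfolding acc_def by auto
    then show ?thesis using N unfolding U_def by blast
  next
    case True
    define D where "D = (\<lambda>s K. s \<subseteq> N \<and> rej N s \<longrightarrow> (\<forall>n\<in>K. (\<forall>i\<in>s. i < n) \<longrightarrow> rej N (insert n s)))"
    have "\<exists>K\<subseteq>N. infinite K \<and> (\<forall>s\<subseteq>K. finite s \<longrightarrow> D s {k\<in>K. \<forall>i\<in>s. i < k})"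
    proof (rule fusion[OF N(2)])
      fix s M' :: "nat set" assume s: "finite s" "infinite M'" "M' \<subseteq> N"
      show "\<exists>K\<subseteq>M'. infinite K \<and> D s K"
      proof (cases "s \<subseteq> N \<and> rej N s")
        case False
        then show ?thesis using s by (auto simp: D_def)
      next
        case rs: True
        define Y where "Y = {n\<in>M'. (\<forall>i\<in>s. i < n) \<and> \<not> rej N (insert n s)}"
        have "finite Y"
        proof (rule ccontr)
          assume "infinite Y"
          moreover have "acc Y s"
            unfolding acc_def
          proof (intro allI impI, elim conjE)
            fix X assume X: "X \<subseteq> Y" "infinite X" "\<forall>i\<in>s. \<forall>k\<in>X. i < k"
            define n where "n = (LEAST n. n \<in> X)"
            have nX: "n \<in> X" unfolding n_def using X(2) by (metis LeastI_ex finite.emptyI ex_in_conv)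
            have nle: "n \<le> k" if "k \<in> X" for k unfolding n_def using that by (rule Least_le)
            have "acc N (insert n s)"
              using decided[of "insert n s"] nX X(1) rs s by (auto simp: Y_def)
            moreover have "\<forall>i\<in>insert n s. \<forall>k\<in>X - {n}. i < k" using nle X(3) by fastforce
            moreover have "X - {n} \<subseteq> N" using X(1) s by (auto simp: Y_def)
            ultimately have "U (insert n s \<union> (X - {n}))"
              using X(2) unfolding acc_def by simp
            moreover have "insert n s \<union> (X - {n}) = s \<union> X" using nX by auto
            ultimately show "U (s \<union> X)" by simp
          qed
          moreover have "Y \<subseteq> N" using s(3) by (auto simp: Y_def)
          ultimately show False using rs unfolding rej_def by blast
        qed
        then have "infinite (M' - Y)" using s by simp
        moreover have "D s (M' - Y)" by (auto simp: D_def Y_def)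
        ultimately show ?thesis by blast
      qed
    qed (auto simp: D_def)
    then obtain K where K: "K \<subseteq> N" "infinite K"
      and DK: "\<And>s. s \<subseteq> K \<Longrightarrow> finite s \<Longrightarrow> D s {k\<in>K. \<forall>i\<in>s. i < k}" by blast
    have rejK: "s \<subseteq> K \<longrightarrow> rej N s" if "finite s" for s
      using that
    proof (induction s rule: finite_linorder_max_induct)
      case empty
      then show ?case using True by simp
    next
      case (insert b A)
      then show ?case using DK[of A] K(1) by (auto simp: D_def)
    qed
    have "s \<notin> \<F>" if s: "s \<subseteq> K" "finite s" for s
    proof
      assume sF: "s \<in> \<F>"
      have "acc N s"
        unfolding acc_def
      proof (intro allI impI, elim conjE)
        fix X assume X: "infinite X" "\<forall>i\<in>s. \<forall>k\<in>X. i < k"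
        show "U (s \<union> X)"
        proof (cases "s = {}")
          case True
          then show ?thesis using sF unfolding U_def by (intro exI[of _ 0]) auto
        next
          case False
          then have "\<forall>k\<in>X. Max s < k" using X(2) s(2) by auto
          then have "(s \<union> X) \<inter> {..<Suc (Max s)} = s"
            using s(2) by (auto simp: less_Suc_eq_le)
          then show ?thesis using sF unfolding U_def by metis
        qed
      qed
      then show False using rejK s N unfolding rej_def by blast
    qed
    then show ?thesis using K N(1) by (intro exI[of _ K]) blast
  qed
qed

text \<open>
  The same dichotomy for increasing sequences, where the family is given by a predicate on lists.
\<close>

lemma nash_williams_lists:
  fixes Q :: "nat list \<Rightarrow> bool"
  assumes "infinite M"
  shows "\<exists>N\<subseteq>M. infinite N \<and> ((\<forall>h m. strict_mono h \<and> range h \<subseteq> N \<longrightarrow> \<not> Q (map h [0..<m])) \<or>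
    (\<forall>h. strict_mono h \<and> range h \<subseteq> N \<longrightarrow> (\<exists>m. Q (map h [0..<m]))))"
proof -
  have list: "sorted_list_of_set (h ` {..<m}) = map h [0..<m]" if "strict_mono h" for h :: "nat \<Rightarrow> nat" and m
  proof -
    have "sorted_wrt (<) (map h [0..<m])"
      using that by (auto simp: sorted_wrt_iff_nth_less strict_mono_less)
    then have "sorted_list_of_set (set (map h [0..<m])) = map h [0..<m]"
      by (intro sorted_list_of_set.idem_if_sorted_distinct) (auto simp: strict_sorted_iff)
    then show ?thesis by (simp add: lessThan_atLeast0)
  qed
  have cut: "\<exists>m. range h \<inter> {..<b} = h ` {..<m}" if h: "strict_mono h" for h :: "nat \<Rightarrow> nat" and b
  proof -
    define m where "m = (LEAST m. b \<le> h m)"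
    have "b \<le> h b" using h by (rule strict_mono_imp_increasing)
    then have "b \<le> h m" unfolding m_def by (rule LeastI)
    moreover have "h k < b" if "k < m" for k
      using not_less_Least[of k "\<lambda>m. b \<le> h m"] that unfolding m_def by auto
    moreover have "k < m" if "h k < b" for k
      using that \<open>b \<le> h m\<close> h by (metis leI less_le_trans not_less strict_mono_less_eq)
    ultimately show ?thesis by (intro exI[of _ m]) auto
  qed
  obtain N where N: "N \<subseteq> M" "infinite N"
    and alt: "(\<forall>s\<subseteq>N. finite s \<longrightarrow> s \<notin> {s. Q (sorted_list_of_set s)}) \<or>
      (\<forall>X\<subseteq>N. infinite X \<longrightarrow> (\<exists>b. X \<inter> {..<b} \<in> {s. Q (sorted_list_of_set s)}))"
    using nash_williams[OF assms, of "{s. Q (sorted_list_of_set s)}"] by blast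
  from alt show ?thesis
  proof
    assume a: "\<forall>s\<subseteq>N. finite s \<longrightarrow> s \<notin> {s. Q (sorted_list_of_set s)}"
    have "\<not> Q (map h [0..<m])" if h: "strict_mono h" "range h \<subseteq> N" for h m
    proof -
      have "h ` {..<m} \<subseteq> N" using h by blast
      then have "\<not> Q (sorted_list_of_set (h ` {..<m}))" using a by simp
      then show ?thesis by (simp add: list h)
    qed
    then show ?thesis using N by blast
  next
    assume a: "\<forall>X\<subseteq>N. infinite X \<longrightarrow> (\<exists>b. X \<inter> {..<b} \<in> {s. Q (sorted_list_of_set s)})"
    have "\<exists>m. Q (map h [0..<m])" if h: "strict_mono h" "range h \<subseteq> N" for h
    proof -
      have "infinite (range h)" using h(1)
        by (metis infinite_iff_countable_subset strict_mono_imp_inj_on subset_refl)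
      then obtain b where "Q (sorted_list_of_set (range h \<inter> {..<b}))" using a h(2) by blast
      then show ?thesis using cut[OF h(1), of b] list[OF h(1)] by metis
    qed
    then show ?thesis using N by blast
  qed
qed

section \<open>Norming functionals\<close>

definition sublinear :: "('a::real_vector \<Rightarrow> real) \<Rightarrow> bool" where
  "sublinear p \<longleftrightarrow> (\<forall>x y. p (x + y) \<le> p x + p y) \<and> (\<forall>c\<ge>0. \<forall>x. p (c *\<^sub>R x) = c * p x)"

lemma sublinearD:
  assumes "sublinear p"
  shows "p (x + y) \<le> p x + p y" and "c \<ge> 0 \<Longrightarrow> p (c *\<^sub>R x) = c * p x" and "p 0 = 0"
    and "- p (- x) \<le> p x"
proof -
  show add: "p (x + y) \<le> p x + p y" for x y using assms unfolding sublinear_def by blast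
  show "c \<ge> 0 \<Longrightarrow> p (c *\<^sub>R x) = c * p x" using assms unfolding sublinear_def by blast
  have "p (0 *\<^sub>R 0) = 0 * p 0" using assms unfolding sublinear_def by blast
  then show "p 0 = 0" by simp
  then show "- p (- x) \<le> p x" using add[of x "- x"] by simp
qed

text \<open>
  The pointwise infimum of \<open>p (x + t v) - t p v\<close> over \<open>t \<ge> 0\<close> is the largest sublinear functional
  below \<open>p\<close> whose value at \<open>- v\<close> is at most \<open>- p v\<close>. Hence a minimal sublinear functional is odd and therefore
  linear; applied to the norm, the same infimum forces a linear functional below it to attain the
  norm at \<open>v\<close>.
\<close>

lemma sublinear_improve:
  fixes p :: "'a::real_vector \<Rightarrow> real"
  assumes p: "sublinear p"
  shows "\<exists>q. sublinear q \<and> (\<forall>x. q x \<le> p x) \<and> q (- v) \<le> - p v"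
proof -
  define S where "S = (\<lambda>x. (\<lambda>t. p (x + t *\<^sub>R v) - t * p v) ` {0..})"
  define q where "q = (\<lambda>x. Inf (S x))"
  have low: "- p (- x) \<le> p (x + t *\<^sub>R v) - t * p v" if "t \<ge> 0" for x t
  proof -
    have "p (t *\<^sub>R v) \<le> p (x + t *\<^sub>R v) + p (- x)"
      using sublinearD(1)[OF p, of "x + t *\<^sub>R v" "- x"] by simp
    then show ?thesis using sublinearD(2)[OF p that] by simp
  qed
  have bdd: "bdd_below (S x)" for x
    unfolding S_def by (rule bdd_belowI[of _ "- p (- x)"]) (auto simp: low)
  have ne: "S x \<noteq> {}" for x by (auto simp: S_def)
  have q_le: "q x \<le> p (x + t *\<^sub>R v) - t * p v" if "t \<ge> 0" for x t
    unfolding q_def using that by (intro cInf_lower bdd) (auto simp: S_def)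
  have q_ge: "y \<le> q x" if "\<And>t. t \<ge> 0 \<Longrightarrow> y \<le> p (x + t *\<^sub>R v) - t * p v" for x y
    unfolding q_def using that by (intro cInf_greatest ne) (auto simp: S_def)
  have "q (x + y) \<le> q x + q y" for x y
  proof -
    have "q (x + y) - q y \<le> p (x + t *\<^sub>R v) - t * p v" if t: "t \<ge> 0" for t
    proof -
      have "q (x + y) - (p (x + t *\<^sub>R v) - t * p v) \<le> p (y + s *\<^sub>R v) - s * p v" if s: "s \<ge> 0" for s
      proof -
        have "q (x + y) \<le> p ((x + t *\<^sub>R v) + (y + s *\<^sub>R v)) - (t + s) * p v"
          using q_le[of "t + s" "x + y"] s t by (simp add: algebra_simps)
        then show ?thesis using sublinearD(1)[OF p, of "x + t *\<^sub>R v" "y + s *\<^sub>R v"]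
          by (simp add: algebra_simps)
      qed
      then show ?thesis using q_ge[of "q (x + y) - (p (x + t *\<^sub>R v) - t * p v)" y] by simp
    qed
    then show ?thesis using q_ge[of "q (x + y) - q y" x] by simp
  qed
  moreover have "q (c *\<^sub>R x) = c * q x" if "c \<ge> 0" for c x
  proof (cases "c = 0")
    case True
    have "0 \<le> q 0"
      using sublinearD(2,3)[OF p] by (intro q_ge) simp
    moreover have "q 0 \<le> 0" using q_le[of 0 0] sublinearD(3)[OF p] by simp
    ultimately show ?thesis using True by simp
  next
    case False
    then have c: "c > 0" using that by simp
    have le: "c * q x \<le> q (c *\<^sub>R x)" if c: "c > 0" for c x
    proof (rule q_ge)
      fix t :: real assume t: "t \<ge> 0"
      have "c * q x \<le> c * (p (x + (t / c) *\<^sub>R v) - (t / c) * p v)"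
        using q_le[of "t / c" x] t c by (intro mult_left_mono) auto
      also have "\<dots> = p (c *\<^sub>R (x + (t / c) *\<^sub>R v)) - t * p v"
        using sublinearD(2)[OF p, of c "x + (t / c) *\<^sub>R v"] c by (simp add: right_diff_distrib)
      also have "\<dots> = p (c *\<^sub>R x + t *\<^sub>R v) - t * p v" using c by (simp add: scaleR_add_right)
      finally show "c * q x \<le> p (c *\<^sub>R x + t *\<^sub>R v) - t * p v" .
    qed
    have "q (c *\<^sub>R x) \<le> c * q x"
      using le[of "1 / c" "c *\<^sub>R x"] c by (simp add: field_simps)
    then show ?thesis using le[OF c] by (simp add: antisym)
  qed
  ultimately have "sublinear q" unfolding sublinear_def by blast
  moreover have "q x \<le> p x" for x using q_le[of 0 x] by simp
  moreover have "q (- v) \<le> - p v" using q_le[of 1 "- v"] sublinearD(3)[OF p] by simp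
  ultimately show ?thesis by blast
qed

lemma minimal_sublinear:
  fixes p :: "'a::real_vector \<Rightarrow> real"
  assumes p: "sublinear p"
  shows "\<exists>u. sublinear u \<and> (\<forall>x. u x \<le> p x) \<and> (\<forall>q. sublinear q \<and> (\<forall>x. q x \<le> u x) \<longrightarrow> q = u)"
proof -
  define A where "A = {q. sublinear q \<and> (\<forall>x. q x \<le> p x)}"
  have "\<exists>m\<in>A. \<forall>a\<in>A. a \<le> m \<longrightarrow> a = m"
  proof (rule predicate_Zorn[where P = "\<lambda>a b. b \<le> a"])
    show "partial_order_on A (relation_of (\<lambda>a b. b \<le> a) A)"
      by (rule partial_order_on_relation_ofI) auto
  next
    fix C assume "C \<in> Chains (relation_of (\<lambda>a b. b \<le> a) A)"
    then have CA: "C \<subseteq> A" and total: "\<And>a b. a \<in> C \<Longrightarrow> b \<in> C \<Longrightarrow> a \<le> b \<or> b \<le> a"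
      by (auto simp: Chains_def relation_of_def)
    show "\<exists>u\<in>A. \<forall>a\<in>C. u \<le> a"
    proof (cases "C = {}")
      case True
      then show ?thesis using p by (auto simp: A_def)
    next
      case False
      define u where "u = (\<lambda>x. INF q\<in>C. q x)"
      have sub: "sublinear q" "q x \<le> p x" if "q \<in> C" for q x using that CA by (auto simp: A_def)
      have bdd: "bdd_below ((\<lambda>q. q x) ` C)" for x
      proof (rule bdd_belowI2[of _ "- p (- x)"])
        fix q assume q: "q \<in> C"
        show "- p (- x) \<le> q x"
          using sublinearD(4)[OF sub(1)[OF q], of x] sub(2)[OF q, of "- x"] by simp
      qed
      have u_le: "u x \<le> q x" if "q \<in> C" for q x
        unfolding u_def by (rule cINF_lower[OF bdd that])
      have u_ge: "y \<le> u x" if "\<And>q. q \<in> C \<Longrightarrow> y \<le> q x" for x y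
        unfolding u_def using that False by (intro cINF_greatest)
      have "u (x + y) \<le> u x + u y" for x y
      proof -
        have "u (x + y) \<le> q x + r y" if q: "q \<in> C" and r: "r \<in> C" for q r
        proof -
          from total[OF q r] show ?thesis
          proof
            assume "q \<le> r"
            then show ?thesis using u_le[OF q, of "x + y"] sublinearD(1)[OF sub(1)[OF q], of x y]
              by (smt (verit) le_fun_def)
          next
            assume "r \<le> q"
            then show ?thesis using u_le[OF r, of "x + y"] sublinearD(1)[OF sub(1)[OF r], of x y]
              by (smt (verit) le_fun_def)
          qed
        qed
        then have "u (x + y) - q x \<le> r y" if "q \<in> C" "r \<in> C" for q r
          using that by (simp add: diff_le_eq add.commute)
        then have "u (x + y) - q x \<le> u y" if "q \<in> C" for q
          using that by (intro u_ge)
        then have "u (x + y) - u y \<le> q x" if "q \<in> C" for q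
          using that by (simp add: diff_le_eq add.commute)
        then have "u (x + y) - u y \<le> u x" by (intro u_ge)
        then show ?thesis by simp
      qed
      moreover have "u (c *\<^sub>R x) = c * u x" if "c \<ge> 0" for c x
      proof -
        have "u (c *\<^sub>R x) = (INF q\<in>C. c * q x)"
          unfolding u_def using sublinearD(2)[OF sub(1) that] by (intro INF_cong) auto
        also have "\<dots> = c * u x"
        proof (cases "c = 0")
          case True
          then show ?thesis using False by simp
        next
          case c: False
          show ?thesis
          proof (rule antisym)
            have "(INF q\<in>C. c * q x) / c \<le> u x"
            proof (rule u_ge)
              fix q assume q: "q \<in> C"
              have "bdd_below ((\<lambda>q. c * q x) ` C)"
                using u_le that by (intro bdd_belowI2[of _ "c * u x"]) (simp add: mult_left_mono)
              then have "(INF q\<in>C. c * q x) \<le> c * q x" using q by (rule cINF_lower)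
              then show "(INF q\<in>C. c * q x) / c \<le> q x" using c that by (simp add: field_simps)
            qed
            then show "(INF q\<in>C. c * q x) \<le> c * u x" using c that by (simp add: field_simps)
            show "c * u x \<le> (INF q\<in>C. c * q x)"
              using u_le that False by (intro cINF_greatest) (auto simp: mult_left_mono)
          qed
        qed
        finally show ?thesis .
      qed
      ultimately have "sublinear u" unfolding sublinear_def by blast
      moreover have "u x \<le> p x" for x
        using False u_le sub(2) by (meson all_not_in_conv order_trans)
      ultimately have "u \<in> A" by (simp add: A_def)
      then show ?thesis using u_le by (auto simp: le_fun_def)
    qed
  qed
  then obtain m where m: "m \<in> A" "\<And>a. a \<in> A \<Longrightarrow> a \<le> m \<Longrightarrow> a = m" by blast
  show ?thesis
  proof (intro exI conjI allI impI)
    show "sublinear m" "\<And>x. m x \<le> p x" using m(1) by (auto simp: A_def)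
    fix q assume q: "sublinear q \<and> (\<forall>x. q x \<le> m x)"
    then have "q \<in> A" using m(1) unfolding A_def by (auto intro: order_trans)
    then show "q = m" using m(2) q by (simp add: le_fun_def)
  qed
qed

text \<open>
  The Hahn--Banach theorem in the form that every sublinear functional has a linear one below it:
  a minimal sublinear functional below \<open>p\<close> cannot be improved, so it is linear.
\<close>

lemma hahn_banach_sublinear:
  fixes p :: "'a::real_vector \<Rightarrow> real"
  assumes p: "sublinear p"
  shows "\<exists>u. linear u \<and> (\<forall>x. u x \<le> p x)"
proof -
  obtain u where u: "sublinear u" "\<And>x. u x \<le> p x"
    and min: "\<And>q. sublinear q \<Longrightarrow> (\<And>x. q x \<le> u x) \<Longrightarrow> q = u"
    using minimal_sublinear[OF p] by blast
  have neg: "u (- v) = - u v" for v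
  proof -
    obtain q where "sublinear q" "\<And>x. q x \<le> u x" "q (- v) \<le> - u v"
      using sublinear_improve[OF u(1), of v] by blast
    then have "u (- v) \<le> - u v" using min by blast
    then show ?thesis using sublinearD(4)[OF u(1), of v] by linarith
  qed
  have "linear u"
  proof (rule linearI)
    fix x y
    have "- u (x + y) \<le> - u x - u y" using sublinearD(1)[OF u(1), of "- x" "- y"]
        neg[of x] neg[of y] neg[of "x + y"] by simp
    then show "u (x + y) = u x + u y" using sublinearD(1)[OF u(1), of x y] by linarith
  next
    fix c x
    show "u (c *\<^sub>R x) = c *\<^sub>R u x"
    proof (cases "c \<ge> 0")
      case True
      then show ?thesis using sublinearD(2)[OF u(1)] by simp
    next
      case False
      then have "u ((- c) *\<^sub>R x) = (- c) * u x" by (intro sublinearD(2)[OF u(1)]) simp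
      then show ?thesis using neg[of "c *\<^sub>R x"] by simp
    qed
  qed
  then show ?thesis using u(2) by blast
qed

lemma norming_functional_real:
  fixes w :: "'a::real_normed_vector"
  shows "\<exists>u. linear u \<and> (\<forall>x. \<bar>u x\<bar> \<le> norm x) \<and> u w = norm w"
proof -
  have "sublinear (norm :: 'a \<Rightarrow> real)" by (auto simp: sublinear_def norm_triangle_ineq)
  then obtain q where q: "sublinear q" "\<And>x. q x \<le> norm x" "q (- w) \<le> - norm w"
    using sublinear_improve[of norm w] by blast
  then obtain u where u: "linear u" "\<And>x. u x \<le> q x" using hahn_banach_sublinear[OF q(1)] by blast
  have le: "u x \<le> norm x" for x using u(2) q(2) order_trans by blast
  have neg: "u (- x) = - u x" for x using linear_neg[OF u(1)] .
  have "\<bar>u x\<bar> \<le> norm x" for x using le[of x] le[of "- x"] neg[of x] by (simp add: abs_le_iff)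
  moreover have "u w = norm w" using u(2)[of "- w"] q(3) le[of w] neg[of w] by linarith
  ultimately show ?thesis using u(1) by blast
qed

text \<open>
  The ball of radius \<open>\<kappa>\<close> of the dual space. Each of the defining conditions is closed under
  pointwise limits and the last one bounds every value, so that Tychonoff's theorem applies to
  the ball as a set of functions.
\<close>

definition dual_ball ::
  "('k::{real_normed_field,euclidean_space} \<Rightarrow> 'a::real_normed_vector \<Rightarrow> 'a) \<Rightarrow> real \<Rightarrow> ('a \<Rightarrow> 'k) set"
  where "dual_ball smul \<kappa> =
    {\<phi>. (\<forall>v w. \<phi> (v + w) = \<phi> v + \<phi> w) \<and> (\<forall>c v. \<phi> (smul c v) = c * \<phi> v) \<and>
      (\<forall>v. norm (\<phi> v) \<le> \<kappa> * norm v)}"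

text \<open>
  Scalar-valued norming functionals come from real ones without knowing whether the field is real
  or complex. For a real-linear \<open>u\<close> and a vector \<open>v\<close>, the map \<open>c \<mapsto> u (c v)\<close> is a real-linear
  functional on the field. The bilinear form \<open>(c, d) \<mapsto> (c d) \<bullet> 1\<close> on the field is nondegenerate, because
  the field has inverses, so exactly one \<open>\<phi> v\<close> satisfies \<open>u (c v) = (c \<phi> v) \<bullet> 1\<close> for all \<open>c\<close>, and
  uniqueness makes \<open>\<phi>\<close> linear over the field. The constant \<open>\<kappa>\<close> compares this form with the norm;
  it depends only on the field.
\<close>

lemma norming_functional:
  fixes smul :: "'k::{real_normed_field,euclidean_space} \<Rightarrow> 'a::real_normed_vector \<Rightarrow> 'a"
  assumes "normed_space_over smul"
  shows "\<exists>\<kappa>>0. \<forall>w. \<exists>\<phi>\<in>dual_ball smul \<kappa>. norm w \<le> norm (\<phi> w)"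
proof -
  interpret normed_space_over smul by fact
  have smul_scaleR: "smul (r *\<^sub>R c) v = r *\<^sub>R smul c v" for r c v
    by (metis scaleR_conv_of_real scale_of_real scale_scale)
  define T where "T = (\<lambda>d::'k. \<Sum>b\<in>Basis. ((b * d) \<bullet> 1) *\<^sub>R b)"
  have T: "c \<bullet> T d = (c * d) \<bullet> 1" for c d
  proof -
    have "(c * d) \<bullet> 1 = ((\<Sum>b\<in>Basis. (c \<bullet> b) *\<^sub>R b) * d) \<bullet> 1" by (simp add: euclidean_representation)
    also have "\<dots> = (\<Sum>b\<in>Basis. (c \<bullet> b) * ((b * d) \<bullet> 1))"
      by (simp add: sum_distrib_right inner_sum_left)
    finally show ?thesis by (simp add: T_def inner_sum_right mult.commute)
  qed
  have T_eqI: "d = d'" if "\<And>c. (c * d) \<bullet> 1 = (c * d') \<bullet> 1" for d d' :: 'k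
  proof (rule ccontr)
    assume "d \<noteq> d'"
    then have "inverse (d - d') * d - inverse (d - d') * d' = 1"
      by (simp add: right_diff_distrib[symmetric])
    then have "(inverse (d - d') * d) \<bullet> 1 - (inverse (d - d') * d') \<bullet> 1 = (1::'k) \<bullet> 1"
      by (metis inner_diff_left)
    then show False using that[of "inverse (d - d')"] by simp
  qed
  have lin_T: "linear T"
    by (rule linearI) (simp_all add: T_def algebra_simps inner_add_left sum.distrib scaleR_sum_right)
  have inj_T: "inj T" using T T_eqI by (intro injI) metis
  have surj_T: "surj T" using lin_T inj_T by (rule linear_inj_imp_surj)
  obtain B where B: "B > 0" "\<And>d. B * norm d \<le> norm (T d)"
    using linear_inj_bounded_below_pos[OF lin_T inj_T] by blast
  define \<kappa> where "\<kappa> = real DIM('k) / B"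
  have "\<kappa> > 0" using B(1) by (simp add: \<kappa>_def)
  moreover have "\<exists>\<phi>\<in>dual_ball smul \<kappa>. norm w \<le> norm (\<phi> w)" for w
  proof -
    obtain u where u: "linear u" "\<And>x. \<bar>u x\<bar> \<le> norm x" "u w = norm w"
      using norming_functional_real by blast
    define y where "y = (\<lambda>v. \<Sum>b\<in>Basis. u (smul b v) *\<^sub>R b)"
    have y: "c \<bullet> y v = u (smul c v)" for c v
    proof -
      have "u (smul c v) = u (smul (\<Sum>b\<in>Basis. (c \<bullet> b) *\<^sub>R b) v)" by (simp add: euclidean_representation)
      also have "\<dots> = (\<Sum>b\<in>Basis. (c \<bullet> b) * u (smul b v))"
        by (simp add: scale_sum_left smul_scaleR linear_sum[OF u(1)] linear_cmul[OF u(1)])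
      finally show ?thesis by (simp add: y_def inner_sum_right mult.commute)
    qed
    define \<phi> where "\<phi> = (\<lambda>v. inv T (y v))"
    have T\<phi>: "T (\<phi> v) = y v" for v unfolding \<phi>_def using surj_T by (simp add: surj_f_inv_f)
    have \<phi>: "(c * \<phi> v) \<bullet> 1 = u (smul c v)" for c v using T[of c "\<phi> v"] T\<phi> y by simp
    have "\<phi> (v + v') = \<phi> v + \<phi> v'" for v v'
      by (rule T_eqI) (simp add: \<phi> distrib_left inner_add_left scale_right_distrib linear_add[OF u(1)])
    moreover have "\<phi> (smul d v) = d * \<phi> v" for d v
      by (rule T_eqI) (simp add: \<phi> mult.assoc[symmetric])
    moreover have "norm (\<phi> v) \<le> \<kappa> * norm v" for v
    proof -
      have "norm (y v) \<le> (\<Sum>b\<in>(Basis::'k set). norm v)"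
        unfolding y_def using u(2)
        by (intro sum_norm_le) (metis norm_scaleR norm_Basis mult.right_neutral norm_scale mult.left_neutral)
      then have "B * norm (\<phi> v) \<le> real DIM('k) * norm v" using B(2)[of "\<phi> v"] by (simp add: T\<phi>)
      then show ?thesis using B(1) by (simp add: \<kappa>_def field_simps)
    qed
    moreover have "norm w \<le> norm (\<phi> w)"
    proof -
      have "norm w = \<phi> w \<bullet> 1" using \<phi>[of 1 w] u(3) by simp
      also have "\<dots> \<le> norm (\<phi> w)" using norm_cauchy_schwarz[of "\<phi> w" 1] by simp
      finally show ?thesis .
    qed
    ultimately show ?thesis unfolding dual_ball_def by blast
  qed
  ultimately show ?thesis by blast
qed

lemma dual_ball_bounded_linear:
  assumes "normed_space_over smul" and "\<phi> \<in> dual_ball smul \<kappa>"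
  shows "bounded_linear \<phi>"
proof -
  interpret normed_space_over smul by fact
  show ?thesis
  proof (rule bounded_linear_intro)
    show "\<phi> (v + w) = \<phi> v + \<phi> w" for v w using assms(2) by (simp add: dual_ball_def)
    show "\<phi> (r *\<^sub>R v) = r *\<^sub>R \<phi> v" for r v
    proof -
      have "\<phi> (smul (of_real r) v) = of_real r * \<phi> v" using assms(2) by (simp add: dual_ball_def)
      then show ?thesis by (simp add: scale_of_real scaleR_conv_of_real)
    qed
    show "norm (\<phi> v) \<le> norm v * \<kappa>" for v using assms(2) by (simp add: dual_ball_def mult.commute)
  qed
qed

section \<open>Compactness of the dual ball\<close>

text \<open>
  The Banach--Alaoglu theorem, for countable and other families of functionals at once: a family is
  a function on pairs of an index and a vector, and the conditions cut a closed set out of a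
  product of balls.
\<close>

lemma compact_dual_ball_families:
  fixes smul :: "'k::{real_normed_field,euclidean_space} \<Rightarrow> 'a::real_normed_vector \<Rightarrow> 'a"
  shows "compact {\<Psi> :: 'i \<times> 'a \<Rightarrow> 'k. \<forall>n. (\<lambda>v. \<Psi> (n, v)) \<in> dual_ball smul \<kappa>}"
proof -
  have "compactin (product_topology (\<lambda>i::'i \<times> 'a. euclidean :: 'k topology) UNIV)
      (PiE UNIV (\<lambda>i. cball 0 (\<kappa> * norm (snd i))))"
    by (subst compactin_PiE) auto
  then have "compact (PiE UNIV (\<lambda>i::'i \<times> 'a. cball (0::'k) (\<kappa> * norm (snd i))))"
    by (simp add: euclidean_product_topology)
  moreover have "closed {\<Psi> :: 'i \<times> 'a \<Rightarrow> 'k. \<forall>n. (\<forall>v w. \<Psi> (n, v + w) = \<Psi> (n, v) + \<Psi> (n, w)) \<and>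
      (\<forall>c v. \<Psi> (n, smul c v) = c * \<Psi> (n, v))}"
    by (intro closed_Collect_all closed_Collect_conj closed_Collect_eq continuous_intros) auto
  ultimately have "compact (PiE UNIV (\<lambda>i::'i \<times> 'a. cball (0::'k) (\<kappa> * norm (snd i))) \<inter>
      {\<Psi>. \<forall>n. (\<forall>v w. \<Psi> (n, v + w) = \<Psi> (n, v) + \<Psi> (n, w)) \<and>
        (\<forall>c v. \<Psi> (n, smul c v) = c * \<Psi> (n, v))})"
    by (rule compact_Int_closed)
  also have "PiE UNIV (\<lambda>i::'i \<times> 'a. cball (0::'k) (\<kappa> * norm (snd i))) \<inter>
      {\<Psi>. \<forall>n. (\<forall>v w. \<Psi> (n, v + w) = \<Psi> (n, v) + \<Psi> (n, w)) \<and>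
        (\<forall>c v. \<Psi> (n, smul c v) = c * \<Psi> (n, v))} =
      {\<Psi>. \<forall>n. (\<lambda>v. \<Psi> (n, v)) \<in> dual_ball smul \<kappa>}"
    unfolding dual_ball_def by (auto simp: PiE_iff)
  finally show ?thesis .
qed

text \<open>
  A compactness form of weak nullness. Each family of functionals is small at all late indices; by
  compactness finitely many indices from \<open>N\<close> suffice for all families, so every family is
  small at some index of a fixed finite window, for the first rows and the first members of the
  family simultaneously.
\<close>

lemma finite_window:
  fixes x :: "nat \<Rightarrow> nat \<Rightarrow> 'a::real_normed_vector"
    and smul :: "'k::{real_normed_field,euclidean_space} \<Rightarrow> 'a \<Rightarrow> 'a"
  assumes sp: "normed_space_over smul" and wn: "\<And>j. weakly_null smul (x j)"
    and "infinite N" and "\<epsilon> > 0"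
  shows "\<exists>G\<subseteq>N. finite G \<and> (\<forall>\<psi>. range \<psi> \<subseteq> dual_ball smul \<kappa> \<longrightarrow>
    (\<exists>q\<in>G. \<forall>n\<le>r. \<forall>j\<le>r. norm (\<psi> n (x j q)) < \<epsilon>))"
proof -
  define K where "K = {\<Psi> :: nat \<times> 'a \<Rightarrow> 'k. \<forall>n. (\<lambda>v. \<Psi> (n, v)) \<in> dual_ball smul \<kappa>}"
  define S where "S = (\<lambda>q. {\<Psi> :: nat \<times> 'a \<Rightarrow> 'k. \<forall>n\<in>{..r}. \<forall>j\<in>{..r}. norm (\<Psi> (n, x j q)) < \<epsilon>})"
  have S_eq: "S q = (\<Inter>n\<in>{..r}. \<Inter>j\<in>{..r}. {\<Psi>. norm (\<Psi> (n, x j q)) < \<epsilon>})" for q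
    by (auto simp: S_def)
  have "open (S q)" for q
    unfolding S_eq by (intro open_INT ballI open_Collect_less continuous_intros) auto
  moreover have "K \<subseteq> (\<Union>q\<in>N. S q)"
  proof
    fix \<Psi> assume \<Psi>: "\<Psi> \<in> K"
    have "(\<lambda>q. \<Psi> (n, x j q)) \<longlonglongrightarrow> 0" for n j
    proof -
      have "(\<lambda>v. \<Psi> (n, v)) \<in> dual_ball smul \<kappa>" using \<Psi> by (simp add: K_def)
      then have "bounded_linear (\<lambda>v. \<Psi> (n, v)) \<and> (\<forall>c v. \<Psi> (n, smul c v) = c * \<Psi> (n, v))"
        using dual_ball_bounded_linear[OF sp] by (auto simp: dual_ball_def)
      then show ?thesis
        using wn[of j, unfolded weakly_null_def, rule_format, of "\<lambda>v. \<Psi> (n, v)"] by blast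
    qed
    then have "eventually (\<lambda>q. norm (\<Psi> (n, x j q)) < \<epsilon>) sequentially" for n j
      using tendstoD[OF _ \<open>\<epsilon> > 0\<close>, of "\<lambda>q. \<Psi> (n, x j q)" 0 sequentially] by simp
    then have "eventually (\<lambda>q. \<forall>n\<in>{..r}. \<forall>j\<in>{..r}. norm (\<Psi> (n, x j q)) < \<epsilon>) sequentially"
      by (intro eventually_ball_finite ballI) auto
    then have "eventually (\<lambda>q. \<Psi> \<in> S q) sequentially" by (simp add: S_def)
    then obtain q0 where "\<And>q. q \<ge> q0 \<Longrightarrow> \<Psi> \<in> S q" by (auto simp: eventually_sequentially)
    moreover obtain q where "q \<in> N" "q \<ge> q0"
      using \<open>infinite N\<close> by (meson infinite_nat_iff_unbounded_le)
    ultimately show "\<Psi> \<in> (\<Union>q\<in>N. S q)" by blast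
  qed
  ultimately obtain G where G: "G \<subseteq> N" "finite G" "K \<subseteq> (\<Union>q\<in>G. S q)"
    using compactE_image[OF compact_dual_ball_families[where 'i = nat, of smul \<kappa>, folded K_def], of N S]
    by metis
  have "\<exists>q\<in>G. \<forall>n\<le>r. \<forall>j\<le>r. norm (\<psi> n (x j q)) < \<epsilon>" if "range \<psi> \<subseteq> dual_ball smul \<kappa>" for \<psi>
  proof -
    have "(\<lambda>(n, v). \<psi> n v) \<in> K" using that by (auto simp: K_def)
    then obtain q where "q \<in> G" "(\<lambda>(n, v). \<psi> n v) \<in> S q" using G(3) by blast
    then show ?thesis by (intro bexI[of _ q]) (auto simp: S_def)
  qed
  then show ?thesis using G by blast
qed

section \<open>Boundedness of basis coefficients\<close>

text \<open>
  Banach's theorem on the basis constant. The sets \<open>E N\<close> of vectors all of whose partial sums are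
  bounded by \<open>N\<close> exhaust the space, so by Baire one of them is dense in a ball. Then each \<open>x\<close> is
  approximated up to half its norm by a vector with partial sums bounded by a multiple of the norm
  of \<open>x\<close>. Iteration writes \<open>x\<close> as a series of such vectors, the bounds forming a geometric series.
  The partial sums of the finite stages converge, uniformly in their length, to partial sums of
  some expansion of \<open>x\<close>, which by uniqueness is the expansion of \<open>x\<close>.
\<close>

lemma schauder_partial_sums_bounded:
  fixes smul :: "'k::{real_normed_field,euclidean_space} \<Rightarrow> 'b::banach \<Rightarrow> 'b"
  assumes sp: "normed_space_over smul" and sb: "schauder_basis smul g"
  shows "\<exists>K. \<forall>a x. (\<lambda>n. smul (a n) (g n)) sums x \<longrightarrow>
    (\<forall>m. norm (\<Sum>n<m. smul (a n) (g n)) \<le> K * norm x)"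
proof -
  interpret normed_space_over smul by fact
  define co where "co = (\<lambda>x. THE a. (\<lambda>n. smul (a n) (g n)) sums x)"
  have ex1: "\<exists>!a. (\<lambda>n. smul (a n) (g n)) sums x" for x
    using sb unfolding schauder_basis_def by (rule spec)
  have co: "(\<lambda>n. smul (co x n) (g n)) sums x" for x
    unfolding co_def by (rule theI'[OF ex1])
  have coI: "a = co x" if "(\<lambda>n. smul (a n) (g n)) sums x" for a x
    unfolding co_def using the1_equality[OF ex1[of x], of a] that by simp
  define P where "P = (\<lambda>m x. \<Sum>n<m. smul (co x n) (g n))"
  have P_tendsto: "(\<lambda>m. P m x) \<longlonglongrightarrow> x" for x using co[of x] by (simp add: sums_def P_def)
  have co_lin: "co (r *\<^sub>R x + s *\<^sub>R y) n = of_real r * co x n + of_real s * co y n" for r s x y n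
  proof -
    have "(\<lambda>n. r *\<^sub>R smul (co x n) (g n) + s *\<^sub>R smul (co y n) (g n)) sums (r *\<^sub>R x + s *\<^sub>R y)"
      by (intro sums_add sums_scaleR_right co)
    then have "(\<lambda>n. smul (of_real r * co x n + of_real s * co y n) (g n)) sums (r *\<^sub>R x + s *\<^sub>R y)"
      by (simp add: scale_left_distrib scale_scale[symmetric] scale_of_real del: scale_scale)
    from coI[OF this] show ?thesis by metis
  qed
  have P_lin: "P m (r *\<^sub>R x + s *\<^sub>R y) = r *\<^sub>R P m x + s *\<^sub>R P m y" for m r s x y
    unfolding P_def co_lin
    by (simp add: scale_left_distrib scale_scale[symmetric] scale_of_real sum.distrib scaleR_sum_right
        del: scale_scale)
  have P_diff: "P m (x - y) = P m x - P m y" for m x y using P_lin[of m 1 x "-1" y] by simp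
  have P_scale: "P m (r *\<^sub>R x) = r *\<^sub>R P m x" for m r x using P_lin[of m r x 0 x] by simp
  define E where "E = (\<lambda>N::nat. {x. \<forall>m. norm (P m x) \<le> real N})"
  have "\<exists>N. x \<in> E N" for x
  proof -
    have "Bseq (\<lambda>m. P m x)" using P_tendsto convergent_def convergent_imp_Bseq by blast
    then obtain c where "\<And>m. norm (P m x) \<le> c" by (auto elim!: BseqE)
    then show ?thesis unfolding E_def
      by (intro exI[of _ "nat \<lceil>c\<rceil>"]) (auto intro: order_trans real_nat_ceiling_ge)
  qed
  then have UN: "(\<Union>(range (\<lambda>N. closure (E N)))) = UNIV" using closure_subset by blast
  have "\<exists>N. interior (closure (E N)) \<noteq> {}"
  proof (rule ccontr)
    assume "\<not> ?thesis"
    then have "euclidean interior_of \<Union>(range (\<lambda>N. closure (E N))) = {}"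
      by (intro Baire_category_alt) (auto simp: completely_metrizable_space_euclidean)
    then show False using UN by simp
  qed
  then obtain N x0 r where "r > 0" and ball0: "ball x0 r \<subseteq> closure (E N)"
    by (metis ex_in_conv mem_interior)
  \<comment> \<open>a small vector \<open>x'\<close> is a difference of two points of the ball, and differences of elements
    of \<open>E N\<close> approximating these two points have controlled partial sums\<close>
  have approx: "\<exists>y. (\<forall>m. norm (P m y) \<le> 4 * real N / r * t) \<and> norm (x - y) \<le> t / 2"
    if x: "norm x \<le> t" and t: "t > 0" for x t
  proof -
    define x' where "x' = (r / (2 * t)) *\<^sub>R x"
    have "norm x' < r"
    proof -
      have "norm x' = r / (2 * t) * norm x" using t \<open>r > 0\<close> by (simp add: x'_def)
      also have "\<dots> \<le> r / (2 * t) * t" using x t \<open>r > 0\<close> by (intro mult_left_mono) auto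
      also have "\<dots> < r" using t \<open>r > 0\<close> by simp
      finally show ?thesis .
    qed
    then have "x0 + x' \<in> closure (E N)" "x0 \<in> closure (E N)"
      using ball0 \<open>r > 0\<close> by (auto simp: subset_iff dist_norm)
    then obtain y1 y2 where y: "y1 \<in> E N" "dist y1 (x0 + x') < r / 8" "y2 \<in> E N" "dist y2 x0 < r / 8"
      unfolding closure_approachable using \<open>r > 0\<close> by (metis divide_pos_pos zero_less_numeral)
    define y where "y = (2 * t / r) *\<^sub>R (y1 - y2)"
    have "norm (P m y) \<le> 4 * real N / r * t" for m
    proof -
      have "norm (P m y) = 2 * t / r * norm (P m y1 - P m y2)"
        using t \<open>r > 0\<close> by (simp add: y_def P_scale P_diff)
      also have "\<dots> \<le> 2 * t / r * (real N + real N)"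
      proof (rule mult_left_mono)
        have "norm (P m y1) \<le> real N" "norm (P m y2) \<le> real N" using y(1,3) by (auto simp: E_def)
        then show "norm (P m y1 - P m y2) \<le> real N + real N"
          using norm_triangle_ineq4[of "P m y1" "P m y2"] by linarith
      qed (use t \<open>r > 0\<close> in simp)
      finally show ?thesis by (simp add: field_simps)
    qed
    moreover have "norm (x - y) \<le> t / 2"
    proof -
      have "x = (2 * t / r) *\<^sub>R x'" using t \<open>r > 0\<close> by (simp add: x'_def)
      then have "norm (x - y) = 2 * t / r * norm (x' - (y1 - y2))"
        using t \<open>r > 0\<close> by (simp add: y_def scaleR_diff_right[symmetric])
      also have "norm (x' - (y1 - y2)) \<le> r / 8 + r / 8"
        using norm_triangle_ineq4[of "(x0 + x') - y1" "x0 - y2"] y(2,4)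
        by (simp add: dist_norm norm_minus_commute algebra_simps)
      finally show ?thesis using t \<open>r > 0\<close> by (simp add: field_simps mult_left_mono)
    qed
    ultimately show ?thesis by blast
  qed
  define M where "M = 4 * real N / r"
  have "norm (P m x) \<le> 2 * M * norm x" for m x
  proof (cases "x = 0")
    case True
    then show ?thesis using P_scale[of m 0 0] by simp
  next
    case False
    define t where "t = norm x"
    have t: "t > 0" using False by (simp add: t_def)
    have "\<exists>s. \<forall>k. (norm (x - s k) \<le> t / 2 ^ k \<and> (k = 0 \<longrightarrow> s k = 0)) \<and>
        (\<forall>m. norm (P m (s (Suc k) - s k)) \<le> M * (t / 2 ^ k))"
    proof (rule dependent_nat_choice)
      show "\<exists>s. norm (x - s) \<le> t / 2 ^ 0 \<and> ((0::nat) = 0 \<longrightarrow> s = 0)" by (simp add: t_def)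
    next
      fix s k assume "norm (x - s) \<le> t / 2 ^ k \<and> (k = 0 \<longrightarrow> s = 0)"
      then obtain y where "\<And>m. norm (P m y) \<le> M * (t / 2 ^ k)" "norm (x - s - y) \<le> t / 2 ^ k / 2"
        using approx[of "x - s" "t / 2 ^ k"] t unfolding M_def by auto
      then show "\<exists>s'. (norm (x - s') \<le> t / 2 ^ Suc k \<and> (Suc k = 0 \<longrightarrow> s' = 0)) \<and>
          (\<forall>m. norm (P m (s' - s)) \<le> M * (t / 2 ^ k))"
        by (intro exI[of _ "s + y"]) (simp add: algebra_simps)
    qed
    then obtain s where s: "\<And>k. norm (x - s k) \<le> t / 2 ^ k" "s 0 = 0"
      and step: "\<And>k m. norm (P m (s (Suc k) - s k)) \<le> M * (t / 2 ^ k)" by metis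
    have M0: "M \<ge> 0" using \<open>r > 0\<close> by (simp add: M_def)
    have tail: "norm (P m (s (k + j)) - P m (s k)) \<le> 2 * M * t * (1 / 2 ^ k - 1 / 2 ^ (k + j))" for m k j
    proof (induction j)
      case 0
      then show ?case by simp
    next
      case (Suc j)
      have "norm (P m (s (k + Suc j)) - P m (s k)) \<le>
          norm (P m (s (Suc (k + j))) - P m (s (k + j))) + norm (P m (s (k + j)) - P m (s k))"
        using norm_triangle_ineq[of "P m (s (Suc (k + j))) - P m (s (k + j))" "P m (s (k + j)) - P m (s k)"]
        by simp
      also have "\<dots> \<le> M * (t / 2 ^ (k + j)) + 2 * M * t * (1 / 2 ^ k - 1 / 2 ^ (k + j))"
        using Suc step[of m "k + j"] by (simp add: P_diff)
      also have "\<dots> = 2 * M * t * (1 / 2 ^ k - 1 / 2 ^ (k + Suc j))"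
        by (simp add: field_simps)
      finally show ?case .
    qed
    have tail': "norm (P m (s l) - P m (s k)) \<le> 2 * M * t / 2 ^ k" if "k \<le> l" for m k l
    proof -
      have "norm (P m (s l) - P m (s k)) \<le> 2 * M * t * (1 / 2 ^ k - 1 / 2 ^ l)"
        using tail[of m k "l - k"] that by simp
      also have "\<dots> \<le> 2 * M * t * (1 / 2 ^ k)" using M0 t by (intro mult_left_mono) auto
      finally show ?thesis by simp
    qed
    have geo: "(\<lambda>k. C / 2 ^ k) \<longlonglongrightarrow> 0" for C :: real
      using tendsto_mult_right_zero[OF LIMSEQ_power_zero[of "1 / 2 :: real"], of C]
      by (simp add: power_one_over)
    have conv: "convergent (\<lambda>k. P m (s k))" for m
    proof (rule Cauchy_convergent, rule metric_CauchyI)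
      fix e :: real assume "e > 0"
      then have "eventually (\<lambda>k. 2 * M * t / 2 ^ k < e / 2) sequentially"
        using order_tendstoD(2)[OF geo, of "e / 2" "2 * M * t"] by simp
      then obtain k where k: "2 * M * t / 2 ^ k < e / 2" by (auto simp: eventually_sequentially)
      show "\<exists>k. \<forall>i\<ge>k. \<forall>j\<ge>k. dist (P m (s i)) (P m (s j)) < e"
      proof (intro exI allI impI)
        fix i j assume "k \<le> i" "k \<le> j"
        then have "dist (P m (s i)) (P m (s k)) < e / 2" "dist (P m (s j)) (P m (s k)) < e / 2"
          using tail'[of k i m] tail'[of k j m] k by (simp_all add: dist_norm)
        then show "dist (P m (s i)) (P m (s j)) < e" by (rule dist_triangle_half_l)
      qed
    qed
    \<comment> \<open>these limits will turn out to be the partial sums of the expansion of \<open>x\<close>\<close>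
    define v where "v = (\<lambda>m. lim (\<lambda>k. P m (s k)))"
    have v: "(\<lambda>k. P m (s k)) \<longlonglongrightarrow> v m" for m
      unfolding v_def using conv by (simp add: convergent_LIMSEQ_iff)
    have v_close: "norm (v m - P m (s k)) \<le> 2 * M * t / 2 ^ k" for m k
    proof (rule tendsto_upperbound)
      show "(\<lambda>l. norm (P m (s l) - P m (s k))) \<longlonglongrightarrow> norm (v m - P m (s k))"
        by (intro tendsto_intros v)
      show "eventually (\<lambda>l. norm (P m (s l) - P m (s k)) \<le> 2 * M * t / 2 ^ k) sequentially"
        using tail' by (auto simp: eventually_sequentially)
    qed simp
    have "\<exists>b. v (Suc m) - v m = smul b (g m)" for m
    proof (cases "g m = 0")
      case True
      have "(\<lambda>k. P (Suc m) (s k) - P m (s k)) \<longlonglongrightarrow> v (Suc m) - v m" by (intro tendsto_intros v)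
      then have "v (Suc m) - v m = 0" using True by (simp add: P_def LIMSEQ_const_iff)
      then show ?thesis by (intro exI[of _ 0]) simp
    next
      case False
      have lim: "(\<lambda>k. smul (co (s k) m) (g m)) \<longlonglongrightarrow> v (Suc m) - v m"
        using tendsto_diff[OF v[of "Suc m"] v[of m]] by (simp add: P_def)
      have "Cauchy (\<lambda>k. co (s k) m)"
      proof (rule metric_CauchyI)
        fix e :: real assume "e > 0"
        then have "e * norm (g m) > 0" using False by simp
        then obtain k0 where k0: "\<And>i j. i \<ge> k0 \<Longrightarrow> j \<ge> k0 \<Longrightarrow>
            dist (smul (co (s i) m) (g m)) (smul (co (s j) m) (g m)) < e * norm (g m)"
          using metric_CauchyD[OF LIMSEQ_imp_Cauchy[OF lim]] by blast
        show "\<exists>k. \<forall>i\<ge>k. \<forall>j\<ge>k. dist (co (s i) m) (co (s j) m) < e"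
          using k0 False
          by (intro exI[of _ k0]) (auto simp: dist_norm scale_left_diff_distrib[symmetric] norm_scale)
      qed
      then obtain b where b: "(\<lambda>k. co (s k) m) \<longlonglongrightarrow> b"
        using Cauchy_convergent convergent_def by blast
      have "(\<lambda>k. smul (co (s k) m) (g m)) \<longlonglongrightarrow> smul b (g m)"
      proof (rule LIM_zero_cancel, rule tendsto_norm_zero_cancel)
        show "(\<lambda>k. norm (smul (co (s k) m) (g m) - smul b (g m))) \<longlonglongrightarrow> 0"
          using tendsto_mult_left_zero[OF tendsto_norm_zero[OF LIM_zero[OF b]], of "norm (g m)"]
          by (simp add: scale_left_diff_distrib[symmetric] norm_scale)
      qed
      then show ?thesis using LIMSEQ_unique[OF lim] by blast
    qed
    then obtain b where b: "\<And>m. v (Suc m) - v m = smul (b m) (g m)" by metis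
    have v0: "v 0 = 0" using v[of 0] by (simp add: P_def LIMSEQ_const_iff)
    have v_sum: "v m = (\<Sum>n<m. smul (b n) (g n))" for m
      using sum_lessThan_telescope[of v m] by (simp add: b v0)
    have "v \<longlonglongrightarrow> x"
    proof (rule metric_LIMSEQ_I)
      fix e :: real assume "e > 0"
      have "eventually (\<lambda>k. (2 * M * t + t) / 2 ^ k < e / 2) sequentially"
        using order_tendstoD(2)[OF geo, of "e / 2" "2 * M * t + t"] \<open>e > 0\<close> by simp
      then obtain k where k: "(2 * M * t + t) / 2 ^ k < e / 2" by (auto simp: eventually_sequentially)
      obtain m0 where m0: "\<And>m. m \<ge> m0 \<Longrightarrow> dist (P m (s k)) (s k) < e / 2"
        using metric_LIMSEQ_D[OF P_tendsto[of "s k"], of "e / 2"] \<open>e > 0\<close> by auto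
      show "\<exists>m0. \<forall>m\<ge>m0. dist (v m) x < e"
      proof (intro exI allI impI)
        fix m assume "m0 \<le> m"
        have "dist (v m) x \<le> norm (v m - P m (s k)) + dist (P m (s k)) (s k) + norm (x - s k)"
          by (metis dist_norm dist_commute add.assoc dist_triangle_le dist_triangle add_left_mono)
        also have "\<dots> < 2 * M * t / 2 ^ k + e / 2 + t / 2 ^ k"
          using v_close[of m k] m0[OF \<open>m0 \<le> m\<close>] s(1)[of k] by linarith
        also have "\<dots> = (2 * M * t + t) / 2 ^ k + e / 2"
          by (simp only: add_divide_distrib add.commute add.left_commute)
        also have "\<dots> < e" using k by linarith
        finally show "dist (v m) x < e" .
      qed
    qed
    then have "(\<lambda>n. smul (b n) (g n)) sums x" unfolding sums_def v_sum[abs_def] .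
    then have "b = co x" by (rule coI)
    then have "P m x = v m" for m by (simp add: P_def v_sum)
    then show ?thesis using v_close[of m 0] P_scale[of m 0 0] by (simp add: s(2) t_def)
  qed
  then have "norm (\<Sum>n<m. smul (a n) (g n)) \<le> 2 * M * norm x"
    if "(\<lambda>n. smul (a n) (g n)) sums x" for a x m
    using coI[OF that] by (simp add: P_def)
  then show ?thesis by blast
qed

text \<open>
  A single term is a difference of two partial sums, and the basis vectors are bounded away from 0.
\<close>

lemma schauder_coefficients_bounded:
  fixes smul :: "'k::{real_normed_field,euclidean_space} \<Rightarrow> 'b::banach \<Rightarrow> 'b"
  assumes sp: "normed_space_over smul" and sb: "schauder_basis smul g" and sn: "seminormalized g"
  shows "\<exists>K>0. \<forall>l::nat \<Rightarrow> nat. strict_mono l \<longrightarrow>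
    (\<forall>a m. \<forall>i<m. norm (a i) \<le> K * norm (\<Sum>i<m. smul (a i) (g (l i))))"
proof -
  interpret normed_space_over smul by fact
  obtain K where K: "\<And>a x m. (\<lambda>n. smul (a n) (g n)) sums x \<Longrightarrow>
      norm (\<Sum>n<m. smul (a n) (g n)) \<le> K * norm x"
    using schauder_partial_sums_bounded[OF sp sb] by blast
  obtain c where c: "c > 0" "\<And>n. c \<le> norm (g n)" using sn unfolding seminormalized_def by blast
  have "norm (a i) \<le> (2 * \<bar>K\<bar> / c + 1) * norm (\<Sum>i<m. smul (a i) (g (l i)))"
    if l: "strict_mono l" and i: "i < m" for l :: "nat \<Rightarrow> nat" and a i m
  proof -
    define b where "b = (\<lambda>n. if n \<in> l ` {..<m} then a (inv l n) else 0)"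
    have inj: "inj l" using l by (rule strict_mono_imp_inj_on)
    have bl: "b (l j) = a j" if "j < m" for j using that inj by (auto simp: b_def)
    define x where "x = (\<Sum>i<m. smul (a i) (g (l i)))"
    have "(\<lambda>n. smul (b n) (g n)) sums (\<Sum>n\<in>l ` {..<m}. smul (b n) (g n))"
      by (rule sums_finite) (auto simp: b_def)
    also have "(\<Sum>n\<in>l ` {..<m}. smul (b n) (g n)) = x"
      using inj bl by (subst sum.reindex) (auto simp: x_def intro: inj_on_subset)
    finally have "(\<lambda>n. smul (b n) (g n)) sums x" .
    note Kx = K[OF this]
    have "norm (a i) * c \<le> norm (smul (b (l i)) (g (l i)))"
      using c(2) bl[OF i] by (simp add: norm_scale mult_left_mono)
    also have "smul (b (l i)) (g (l i)) =
        (\<Sum>n<Suc (l i). smul (b n) (g n)) - (\<Sum>n<l i. smul (b n) (g n))" by simp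
    also have "norm \<dots> \<le> K * norm x + K * norm x"
      by (rule order_trans[OF norm_triangle_ineq4 add_mono[OF Kx Kx]])
    also have "\<dots> \<le> 2 * \<bar>K\<bar> * norm x"
      using mult_right_mono[OF abs_ge_self[of K], of "norm x"] by simp
    finally have "norm (a i) \<le> 2 * \<bar>K\<bar> / c * norm x" using c(1) by (simp add: field_simps)
    then show ?thesis unfolding x_def[symmetric] distrib_right using norm_ge_zero[of x] by linarith
  qed
  moreover have "2 * \<bar>K\<bar> / c + 1 > 0" using c(1) by (simp add: add_nonneg_pos)
  ultimately show ?thesis by blast
qed

section \<open>Domination and right dominance\<close>

lemma C_dominates_iff_initial:
  fixes smul_f :: "'k::{real_normed_field,euclidean_space} \<Rightarrow> 'b::real_normed_vector \<Rightarrow> 'b"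
    and smul_e :: "'k \<Rightarrow> 'a::real_normed_vector \<Rightarrow> 'a"
  assumes "normed_space_over smul_f" and "normed_space_over smul_e"
  shows "C_dominates C smul_f f smul_e e \<longleftrightarrow>
    (\<forall>a m. norm (\<Sum>i<m. smul_e (a i) (e i)) \<le> C * norm (\<Sum>i<m. smul_f (a i) (f i)))"
proof -
  interpret F: normed_space_over smul_f by fact
  interpret E: normed_space_over smul_e by fact
  show ?thesis
  proof
    assume dom: "C_dominates C smul_f f smul_e e"
    show "\<forall>a m. norm (\<Sum>i<m. smul_e (a i) (e i)) \<le> C * norm (\<Sum>i<m. smul_f (a i) (f i))"
    proof (intro allI)
      fix a :: "nat \<Rightarrow> 'k" and m
      define b where "b = (\<lambda>i. if i < m then a i else 0)"
      have sub: "{i. b i \<noteq> 0} \<subseteq> {..<m}" by (auto simp: b_def)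
      have "(\<Sum>i<m. smul_e (a i) (e i)) = (\<Sum>i | b i \<noteq> 0. smul_e (b i) (e i))"
        using sub by (intro sum.mono_neutral_cong_right) (auto simp: b_def)
      moreover have "(\<Sum>i<m. smul_f (a i) (f i)) = (\<Sum>i | b i \<noteq> 0. smul_f (b i) (f i))"
        using sub by (intro sum.mono_neutral_cong_right) (auto simp: b_def)
      ultimately show "norm (\<Sum>i<m. smul_e (a i) (e i)) \<le> C * norm (\<Sum>i<m. smul_f (a i) (f i))"
        using dom finite_subset[OF sub] unfolding C_dominates_def by simp
    qed
  next
    assume dom: "\<forall>a m. norm (\<Sum>i<m. smul_e (a i) (e i)) \<le> C * norm (\<Sum>i<m. smul_f (a i) (f i))"
    show "C_dominates C smul_f f smul_e e"
      unfolding C_dominates_def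
    proof (intro allI impI)
      fix a :: "nat \<Rightarrow> 'k" assume fin: "finite {n. a n \<noteq> 0}"
      then obtain m where sub: "{n. a n \<noteq> 0} \<subseteq> {..<m}"
        by (metis finite_nat_iff_bounded)
      have "(\<Sum>n | a n \<noteq> 0. smul_e (a n) (e n)) = (\<Sum>i<m. smul_e (a i) (e i))"
        using sub by (intro sum.mono_neutral_left) auto
      moreover have "(\<Sum>n | a n \<noteq> 0. smul_f (a n) (f n)) = (\<Sum>i<m. smul_f (a i) (f i))"
        using sub by (intro sum.mono_neutral_left) auto
      ultimately show "norm (\<Sum>n | a n \<noteq> 0. smul_e (a n) (e n)) \<le> C * norm (\<Sum>n | a n \<noteq> 0. smul_f (a n) (f n))"
        using dom by simp
    qed
  qed
qed

lemma C_dominates_subseq: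
  fixes smul_f :: "'k::{real_normed_field,euclidean_space} \<Rightarrow> 'b::real_normed_vector \<Rightarrow> 'b"
    and smul_e :: "'k \<Rightarrow> 'a::real_normed_vector \<Rightarrow> 'a"
  assumes "C_dominates C smul_f f smul_e e" and "strict_mono u"
  shows "C_dominates C smul_f (f \<circ> u) smul_e (e \<circ> u)"
  unfolding C_dominates_def
proof (intro allI impI)
  fix a :: "nat \<Rightarrow> 'k" assume fin: "finite {n. a n \<noteq> 0}"
  define b where "b = (\<lambda>n. if n \<in> range u then a (inv u n) else 0)"
  have inj: "inj u" using assms(2) by (rule strict_mono_imp_inj_on)
  have bu: "b (u j) = a j" for j using inj by (auto simp: b_def)
  have set: "{n. b n \<noteq> 0} = u ` {n. a n \<noteq> 0}" using inj by (auto simp: b_def inj_eq)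
  have re: "(\<Sum>n\<in>u ` {n. a n \<noteq> 0}. h n) = (\<Sum>n | a n \<noteq> 0. h (u n))" for h :: "nat \<Rightarrow> 'c::comm_monoid_add"
    using inj by (subst sum.reindex) (auto intro: inj_on_subset)
  have "finite {n. b n \<noteq> 0}" unfolding set using fin by (rule finite_imageI)
  then have "norm (\<Sum>n | b n \<noteq> 0. smul_e (b n) (e n)) \<le> C * norm (\<Sum>n | b n \<noteq> 0. smul_f (b n) (f n))"
    using assms(1) unfolding C_dominates_def by blast
  then show "norm (\<Sum>n | a n \<noteq> 0. smul_e (a n) ((e \<circ> u) n)) \<le>
      C * norm (\<Sum>n | a n \<noteq> 0. smul_f (a n) ((f \<circ> u) n))"
    unfolding set re bu by simp
qed

text \<open>
  Right dominance has a uniform constant, at least for sequences that start late enough. Otherwise there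
  are finite pieces of pairs of sequences, as late as desired, on which the constants exceed every
  bound in turn. Concatenating them yields one pair for which domination fails.
\<close>

lemma uniform_right_dominance:
  fixes smul :: "'k::{real_normed_field,euclidean_space} \<Rightarrow> 'b::real_normed_vector \<Rightarrow> 'b"
  assumes sp: "normed_space_over smul" and rd: "right_dominant smul g"
  shows "\<exists>N B. \<forall>m l :: nat \<Rightarrow> nat. strict_mono m \<and> strict_mono l \<and> (\<forall>n. m n \<le> l n) \<and> N \<le> m 0 \<longrightarrow>
    C_dominates B smul (g \<circ> l) smul (g \<circ> m)"
proof (rule ccontr)
  interpret normed_space_over smul by fact
  assume neg: "\<not> ?thesis"
  have witness: "\<exists>m l (k::nat) a. strict_mono m \<and> strict_mono l \<and> (\<forall>n. m n \<le> l n) \<and> N \<le> m 0 \<and>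
      B * norm (\<Sum>i<k. smul (a i) (g (l i))) < norm (\<Sum>i<k. smul (a i) (g (m i)))" for N B
  proof -
    obtain m l where ml: "strict_mono m" "strict_mono l" "\<forall>n. m n \<le> l n" "N \<le> m 0"
      and "\<not> C_dominates B smul (g \<circ> l) smul (g \<circ> m)"
      using neg by blast
    then obtain a k where "B * norm (\<Sum>i<k. smul (a i) (g (l i))) < norm (\<Sum>i<k. smul (a i) (g (m i)))"
      using C_dominates_iff_initial[OF sp sp, of B "g \<circ> l" "g \<circ> m"] by (auto simp: not_le)
    then show ?thesis
      using ml by (intro exI[of _ m] exI[of _ l] exI[of _ k] exI[of _ a] conjI)
  qed
  define W where "W = (\<lambda>(N::nat) (B::real) (m::nat \<Rightarrow> nat, l::nat \<Rightarrow> nat, k::nat, a::nat \<Rightarrow> 'k).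
    strict_mono m \<and> strict_mono l \<and> (\<forall>n. m n \<le> l n) \<and> N \<le> m 0 \<and>
    B * norm (\<Sum>i<k. smul (a i) (g (l i))) < norm (\<Sum>i<k. smul (a i) (g (m i))))"
  have "\<exists>p. W N B p" for N B using witness[of N B] by (auto simp: W_def)
  then obtain F where F: "\<And>N B. W N B (F N B)" by metis
  define m l k a where "m = (\<lambda>N B. fst (F N B))" and "l = (\<lambda>N B. fst (snd (F N B)))"
    and "k = (\<lambda>N B. fst (snd (snd (F N B))))" and "a = (\<lambda>N B. snd (snd (snd (F N B))))"
  have m: "strict_mono (m N B)" and l: "strict_mono (l N B)"
    and ml: "m N B n \<le> l N B n" and mN: "N \<le> m N B 0"
    and bad: "B * norm (\<Sum>i<k N B. smul (a N B i) (g (l N B i))) <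
      norm (\<Sum>i<k N B. smul (a N B i) (g (m N B i)))" for N B n
    using F[of N B] by (auto simp: W_def m_def l_def k_def a_def split: prod.splits)
  \<comment> \<open>\<open>S j\<close> is a starting point beyond all indices used by the pieces before the \<open>j\<close>-th one\<close>
  define S where "S = rec_nat 0 (\<lambda>j N. Suc (l N (real j) (k N (real j))))"
  define M where "M = (\<lambda>j. m (S j) (real j))"
  define L where "L = (\<lambda>j. l (S j) (real j))"
  define d where "d = (\<lambda>j. k (S j) (real j))"
  define c where "c = (\<lambda>j. a (S j) (real j))"
  have S_Suc: "S (Suc j) = Suc (L j (d j))" for j by (simp add: S_def L_def d_def)
  have M: "strict_mono (M j)" and L: "strict_mono (L j)" and M_le_L: "M j n \<le> L j n" and MS: "S j \<le> M j 0"
    and badj: "real j * norm (\<Sum>i<d j. smul (c j i) (g (L j i))) <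
      norm (\<Sum>i<d j. smul (c j i) (g (M j i)))" for j n
    using m l ml mN bad by (auto simp: M_def L_def d_def c_def)
  have d_pos: "d j > 0" for j using badj[of j] by (cases "d j") auto
  define pos where "pos = (\<lambda>j. \<Sum>i<j. d i)"
  have pos_Suc: "pos (Suc j) = pos j + d j" for j by (simp add: pos_def)
  have pos_mono: "strict_mono pos" by (rule strict_monoI_Suc) (simp add: pos_Suc d_pos)
  define J where "J = (\<lambda>n. LEAST j. n < pos (Suc j))"
  have J_eq: "J n = j" if "pos j \<le> n" "n < pos (Suc j)" for n j
    unfolding J_def
  proof (rule Least_equality)
    show "n < pos (Suc j)" by fact
    fix i assume "n < pos (Suc i)"
    then have "pos j < pos (Suc i)" using that(1) by simp
    then show "j \<le> i" using pos_mono by (simp add: strict_mono_less)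
  qed
  have J: "pos (J n) \<le> n" "n < pos (Suc (J n))" for n
  proof -
    have "n < pos (Suc n)" using strict_mono_imp_increasing[OF pos_mono, of "Suc n"] by simp
    then show "n < pos (Suc (J n))" unfolding J_def by (rule LeastI)
    show "pos (J n) \<le> n"
    proof (cases "J n")
      case 0
      then show ?thesis by (simp add: pos_def)
    next
      case (Suc j)
      then show ?thesis using not_less_Least[of j "\<lambda>j. n < pos (Suc j)"] by (simp add: J_def not_less)
    qed
  qed
  \<comment> \<open>at position \<open>n\<close> the concatenation is inside the piece \<open>J n\<close>, which begins at \<open>pos (J n)\<close>\<close>
  define glue where "glue = (\<lambda>(h::nat \<Rightarrow> nat \<Rightarrow> nat) n. h (J n) (n - pos (J n)))"
  have glue_at: "glue h (pos j + i) = h j i" if "i < d j" for h j i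
    using J_eq[of j "pos j + i"] that by (simp add: glue_def pos_Suc)
  have glue_mono: "strict_mono (glue h)"
    if h: "\<And>j. strict_mono (h j)" and low: "\<And>j. S j \<le> h j 0" and up: "\<And>j n. h j n \<le> L j n" for h
  proof (rule strict_monoI_Suc)
    fix n
    define j i where "j = J n" and "i = n - pos (J n)"
    have n: "n = pos j + i" "i < d j" using J[of n] by (auto simp: j_def i_def pos_Suc)
    show "glue h n < glue h (Suc n)"
    proof (cases "Suc i < d j")
      case True
      then show ?thesis using glue_at[of i j h] glue_at[of "Suc i" j h] n h[of j]
        by (simp add: strict_mono_less)
    next
      case False
      then have "Suc n = pos (Suc j) + 0" using n by (simp add: pos_Suc)
      then have "glue h (Suc n) = h (Suc j) 0" using glue_at[of 0 "Suc j" h] d_pos by simp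
      moreover have "h j i \<le> L j (d j)"
        using up[of j i] L[of j] n(2) by (meson less_imp_le order_trans strict_mono_less_eq)
      ultimately show ?thesis using glue_at[OF n(2), of h] n low[of "Suc j"] S_Suc[of j] by simp
    qed
  qed
  have "strict_mono (glue M)" using M MS M_le_L by (rule glue_mono)
  moreover have "strict_mono (glue L)" using L order_trans[OF MS M_le_L] by (intro glue_mono) auto
  moreover have "\<forall>n. glue M n \<le> glue L n" using M_le_L by (simp add: glue_def)
  ultimately obtain C where C: "C_dominates C smul (g \<circ> glue L) smul (g \<circ> glue M)"
    using rd unfolding right_dominant_def dominates_def by blast
  define j where "j = nat \<lceil>C\<rceil>"
  define b where "b = (\<lambda>n. if n < pos j then 0 else c j (n - pos j))"
  have piece: "(\<Sum>n<pos (Suc j). smul (b n) (g (glue h n))) = (\<Sum>i<d j. smul (c j i) (g (h j i)))" for h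
  proof -
    have "(\<Sum>n<pos (Suc j). smul (b n) (g (glue h n))) = (\<Sum>n\<in>{pos j..<pos j + d j}. smul (b n) (g (glue h n)))"
      by (intro sum.mono_neutral_right) (auto simp: b_def pos_Suc)
    also have "\<dots> = (\<Sum>i<d j. smul (b (pos j + i)) (g (glue h (pos j + i))))"
      by (rule sum.reindex_bij_witness[of _ "\<lambda>i. pos j + i" "\<lambda>n. n - pos j"]) auto
    also have "\<dots> = (\<Sum>i<d j. smul (c j i) (g (h j i)))"
      by (intro sum.cong) (auto simp: b_def glue_at)
    finally show ?thesis .
  qed
  have "norm (\<Sum>i<d j. smul (c j i) (g (M j i))) \<le> C * norm (\<Sum>i<d j. smul (c j i) (g (L j i)))"
    using C[unfolded C_dominates_iff_initial[OF sp sp], rule_format, of b "pos (Suc j)"]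
    unfolding comp_apply piece .
  also have "\<dots> \<le> real j * norm (\<Sum>i<d j. smul (c j i) (g (L j i)))"
    unfolding j_def by (intro mult_right_mono real_nat_ceiling_ge) simp
  finally show False using badj[of j] by simp
qed

lemma fast_convergent_subseq:
  fixes X :: "nat \<Rightarrow> real"
  assumes "X \<longlonglongrightarrow> L"
  shows "\<exists>u. strict_mono u \<and> (\<forall>i. \<bar>X (u i) - L\<bar> \<le> (1/2) ^ i)"
proof -
  have ev: "\<exists>n0. \<forall>n\<ge>n0. \<bar>X n - L\<bar> \<le> (1/2) ^ i" for i
    using LIMSEQ_D[OF assms, of "(1/2) ^ i"] by (auto intro: less_imp_le)
  have "\<exists>u. \<forall>i. \<bar>X (u i) - L\<bar> \<le> (1/2) ^ i \<and> u i < u (Suc i)"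
  proof (rule dependent_nat_choice)
    show "\<exists>x. \<bar>X x - L\<bar> \<le> (1/2) ^ 0" using ev[of 0] by blast
    fix x i assume "\<bar>X x - L\<bar> \<le> (1/2) ^ i"
    obtain n0 where "\<forall>n\<ge>n0. \<bar>X n - L\<bar> \<le> (1/2) ^ Suc i" using ev by blast
    then show "\<exists>y. \<bar>X y - L\<bar> \<le> (1/2) ^ Suc i \<and> x < y" by (intro exI[of _ "max n0 (Suc x)"]) auto
  qed
  then show ?thesis using strict_monoI_Suc by blast
qed

lemma sum_half_powers_le: "(\<Sum>i<m. (1/2::real) ^ i) \<le> 2"
  by (simp add: sum_gp_strict)

lemma weakly_null_subseq:
  assumes "weakly_null smul x" "strict_mono r"
  shows "weakly_null smul (x \<circ> r)"
  unfolding weakly_null_def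
proof (intro allI impI)
  fix \<phi> assume "bounded_linear \<phi> \<and> (\<forall>c v. \<phi> (smul c v) = c * \<phi> v)"
  then have "(\<lambda>n. \<phi> (x n)) \<longlonglongrightarrow> 0" using assms(1) unfolding weakly_null_def by blast
  from LIMSEQ_subseq_LIMSEQ[OF this assms(2)] show "(\<lambda>n. \<phi> ((x \<circ> r) n)) \<longlonglongrightarrow> 0"
    by (simp add: comp_def)
qed

text \<open>
  The domination hypothesis passes from normalized to bounded weakly null sequences. Along a
  subsequence the norms converge to a limit \<open>\<rho>\<close> as fast as \<open>(1/2) ^ i\<close>. For \<open>\<rho> = 0\<close> the series of
  norms alone gives domination, because the coefficients are controlled by the basis. For \<open>\<rho> > 0\<close>
  the sequence rescaled to norm one is dominated; multiplying the coefficients by the norms differs from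
  multiplying them by \<open>\<rho>\<close> by an error that is again controlled by the coefficients.
\<close>

lemma bounded_weakly_null_dominated:
  fixes smulG :: "'k::{real_normed_field,euclidean_space} \<Rightarrow> 'g::banach \<Rightarrow> 'g"
    and smulX :: "'k \<Rightarrow> 'x::banach \<Rightarrow> 'x"
  assumes spG: "normed_space_over smulG" and spX: "normed_space_over smulX"
    and coeff: "\<And>(l :: nat \<Rightarrow> nat) a m i. strict_mono l \<Longrightarrow> i < m \<Longrightarrow>
      norm (a i) \<le> K * norm (\<Sum>i<m. smulG (a i) (g (l i)))"
    and K: "K \<ge> 0" and bdd_g: "\<And>n. norm (g n) \<le> D"
    and hyp: "\<And>x :: nat \<Rightarrow> 'x. normalized x \<Longrightarrow> weakly_null smulX x \<Longrightarrow>
      \<exists>r s. strict_mono r \<and> strict_mono s \<and> dominates smulG (g \<circ> s) smulX (x \<circ> r)"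
    and wn: "weakly_null smulX z" and bdd: "\<And>k. norm (z k) \<le> R"
  shows "\<exists>r s C. strict_mono r \<and> strict_mono s \<and> C \<ge> 0 \<and> C_dominates C smulG (g \<circ> s) smulX (z \<circ> r)"
proof -
  interpret G: normed_space_over smulG by fact
  interpret X: normed_space_over smulX by fact
  have D: "D \<ge> 0" using bdd_g[of 0] norm_ge_zero order_trans by blast
  have coeff_sum: "(\<Sum>i<m. norm (a i) * (1/2) ^ i) \<le> 2 * K * norm (\<Sum>i<m. smulG (a i) (g (l i)))"
    if "strict_mono l" for l :: "nat \<Rightarrow> nat" and a m
  proof -
    have "(\<Sum>i<m. norm (a i) * (1/2) ^ i) \<le>
        (\<Sum>i<m. K * norm (\<Sum>i<m. smulG (a i) (g (l i))) * (1/2) ^ i)"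
      using coeff[OF that] by (intro sum_mono mult_right_mono) auto
    also have "\<dots> = K * norm (\<Sum>i<m. smulG (a i) (g (l i))) * (\<Sum>i<m. (1/2) ^ i)"
      by (simp add: sum_distrib_left)
    also have "\<dots> \<le> K * norm (\<Sum>i<m. smulG (a i) (g (l i))) * 2"
      using K by (intro mult_left_mono sum_half_powers_le) auto
    finally show ?thesis by simp
  qed
  have "bounded (range (\<lambda>k. norm (z k)))" using bdd by (auto simp: bounded_iff)
  then obtain \<rho> t where t: "strict_mono t" and lim: "((\<lambda>k. norm (z k)) \<circ> t) \<longlonglongrightarrow> \<rho>"
    using bounded_imp_convergent_subsequence by blast
  have "\<rho> \<ge> 0" by (rule LIMSEQ_le_const[OF lim]) auto
  then consider "\<rho> = 0" | "\<rho> > 0" by linarith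
  then show ?thesis
  proof cases
    case 1
    then obtain u where u: "strict_mono u" "\<And>i. norm (z (t (u i))) \<le> (1/2) ^ i"
      using fast_convergent_subseq[OF lim] by auto
    have "C_dominates (2 * K) smulG (g \<circ> id) smulX (z \<circ> (t \<circ> u))"
      unfolding C_dominates_iff_initial[OF spG spX]
    proof (intro allI)
      fix a :: "nat \<Rightarrow> 'k" and m
      have "norm (\<Sum>i<m. smulX (a i) ((z \<circ> (t \<circ> u)) i)) \<le> (\<Sum>i<m. norm (a i) * (1/2) ^ i)"
        using u(2) by (intro sum_norm_le) (simp add: X.norm_scale mult_left_mono)
      also have "\<dots> \<le> 2 * K * norm (\<Sum>i<m. smulG (a i) (g (id i)))"
        by (rule coeff_sum) (simp add: strict_mono_def)
      finally show "norm (\<Sum>i<m. smulX (a i) ((z \<circ> (t \<circ> u)) i)) \<le>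
          2 * K * norm (\<Sum>i<m. smulG (a i) ((g \<circ> id) i))" by simp
    qed
    moreover have "strict_mono (t \<circ> u)" "strict_mono (id :: nat \<Rightarrow> nat)"
      using t u(1) by (auto simp: strict_mono_def)
    ultimately show ?thesis using K by (metis mult_nonneg_nonneg zero_le_numeral)
  next
    case 2
    obtain k0 where k0: "\<And>k. k \<ge> k0 \<Longrightarrow> norm (z (t k)) > 0"
      using order_tendstoD(1)[OF lim 2] by (auto simp: eventually_sequentially)
    define w where "w = (\<lambda>k. z (t (k + k0)))"
    define \<beta> where "\<beta> = (\<lambda>k. norm (w k))"
    define y where "y = (\<lambda>k. (1 / \<beta> k) *\<^sub>R w k)"
    have \<beta>_pos: "\<beta> k > 0" for k using k0 by (simp add: \<beta>_def w_def)
    have \<beta>_lim: "\<beta> \<longlonglongrightarrow> \<rho>"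
      using LIMSEQ_ignore_initial_segment[OF lim, of k0] by (simp add: \<beta>_def w_def comp_def)
    have w_eq: "w k = \<beta> k *\<^sub>R y k" for k using \<beta>_pos[of k] by (simp add: y_def)
    have mono_w: "strict_mono (\<lambda>k. t (k + k0))" using t by (simp add: strict_mono_def)
    have wn_w: "weakly_null smulX w"
      using weakly_null_subseq[OF wn mono_w] by (simp add: w_def comp_def)
    have "normalized y" using \<beta>_pos by (auto simp: normalized_def y_def \<beta>_def)
    moreover have "weakly_null smulX y"
      unfolding weakly_null_def
    proof (intro allI impI, elim conjE)
      fix \<phi> :: "'x \<Rightarrow> 'k" assume \<phi>: "bounded_linear \<phi>" "\<forall>c v. \<phi> (smulX c v) = c * \<phi> v"
      then have "(\<lambda>k. \<phi> (w k)) \<longlonglongrightarrow> 0" using wn_w by (simp add: weakly_null_def)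
      then have "(\<lambda>k. (1 / \<beta> k) *\<^sub>R \<phi> (w k)) \<longlonglongrightarrow> (1 / \<rho>) *\<^sub>R 0"
        using 2 by (intro tendsto_intros \<beta>_lim) auto
      then show "(\<lambda>k. \<phi> (y k)) \<longlonglongrightarrow> 0"
        by (simp add: y_def linear_cmul[OF bounded_linear.linear[OF \<phi>(1)]])
    qed
    ultimately obtain r s where r: "strict_mono r" and s: "strict_mono s"
      and "dominates smulG (g \<circ> s) smulX (y \<circ> r)" using hyp by blast
    then obtain C where C: "C_dominates C smulG (g \<circ> s) smulX (y \<circ> r)"
      unfolding dominates_def by blast
    obtain u where u: "strict_mono u" "\<And>i. \<bar>\<beta> (r (u i)) - \<rho>\<bar> \<le> (1/2) ^ i"
      using fast_convergent_subseq[OF LIMSEQ_subseq_LIMSEQ[OF \<beta>_lim r]] by auto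
    have su: "strict_mono (s \<circ> u)" using s u(1) by (simp add: strict_mono_def)
    have Cu: "norm (\<Sum>i<m. smulX (a i) (y (r (u i)))) \<le> \<bar>C\<bar> * norm (\<Sum>i<m. smulG (a i) (g (s (u i))))"
      for a m
    proof -
      have "norm (\<Sum>i<m. smulX (a i) (y (r (u i)))) \<le> C * norm (\<Sum>i<m. smulG (a i) (g (s (u i))))"
        using C_dominates_subseq[OF C u(1)] unfolding C_dominates_iff_initial[OF spG spX] by simp
      also have "\<dots> \<le> \<bar>C\<bar> * norm (\<Sum>i<m. smulG (a i) (g (s (u i))))"
        by (intro mult_right_mono) auto
      finally show ?thesis .
    qed
    have "C_dominates (\<bar>C\<bar> * (\<rho> + 2 * K * D)) smulG (g \<circ> (s \<circ> u)) smulX (z \<circ> (\<lambda>i. t (r (u i) + k0)))"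
      unfolding C_dominates_iff_initial[OF spG spX]
    proof (intro allI)
      fix a :: "nat \<Rightarrow> 'k" and m
      have split: "smulG (c * of_real b) v = \<rho> *\<^sub>R smulG c v + smulG (c * of_real (b - \<rho>)) v" for c b v
      proof -
        have "c * of_real b = of_real \<rho> * c + c * of_real (b - \<rho>)" by (simp add: algebra_simps)
        then show ?thesis
          by (simp only: G.scale_left_distrib G.scale_scale[symmetric] G.scale_of_real)
      qed
      define A where "A = norm (\<Sum>i<m. smulG (a i) (g (s (u i))))"
      have "(\<Sum>i<m. smulG (a i * of_real (\<beta> (r (u i)))) (g (s (u i)))) =
          \<rho> *\<^sub>R (\<Sum>i<m. smulG (a i) (g (s (u i)))) +
          (\<Sum>i<m. smulG (a i * of_real (\<beta> (r (u i)) - \<rho>)) (g (s (u i))))"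
        by (simp only: scaleR_sum_right sum.distrib[symmetric] split[symmetric])
      also have "norm \<dots> \<le> \<rho> * A + 2 * K * D * A"
      proof (rule order_trans[OF norm_triangle_ineq add_mono])
        show "norm (\<rho> *\<^sub>R (\<Sum>i<m. smulG (a i) (g (s (u i))))) \<le> \<rho> * A"
          using 2 by (simp add: A_def)
        have "norm (\<Sum>i<m. smulG (a i * of_real (\<beta> (r (u i)) - \<rho>)) (g (s (u i)))) \<le>
            (\<Sum>i<m. norm (a i) * (1/2) ^ i * D)"
        proof (rule sum_norm_le)
          fix i
          have "norm (smulG (a i * of_real (\<beta> (r (u i)) - \<rho>)) (g (s (u i)))) =
              norm (a i) * \<bar>\<beta> (r (u i)) - \<rho>\<bar> * norm (g (s (u i)))"
            by (simp only: G.norm_scale norm_mult norm_of_real)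
          also have "\<dots> \<le> norm (a i) * (1/2) ^ i * D"
            using u(2) bdd_g D by (intro mult_mono mult_left_mono) auto
          finally show "norm (smulG (a i * of_real (\<beta> (r (u i)) - \<rho>)) (g (s (u i)))) \<le>
              norm (a i) * (1/2) ^ i * D" .
        qed
        also have "\<dots> = (\<Sum>i<m. norm (a i) * (1/2) ^ i) * D" by (simp add: sum_distrib_right)
        also have "\<dots> \<le> 2 * K * A * D"
          using coeff_sum[OF su, of a m] D by (intro mult_right_mono) (simp_all add: A_def)
        finally show "norm (\<Sum>i<m. smulG (a i * of_real (\<beta> (r (u i)) - \<rho>)) (g (s (u i)))) \<le> 2 * K * D * A"
          by (simp add: ac_simps)
      qed
      finally have bound: "norm (\<Sum>i<m. smulG (a i * of_real (\<beta> (r (u i)))) (g (s (u i)))) \<le>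
          (\<rho> + 2 * K * D) * A" by (simp only: distrib_right)
      have "(\<Sum>i<m. smulX (a i) ((z \<circ> (\<lambda>i. t (r (u i) + k0))) i)) =
          (\<Sum>i<m. smulX (a i * of_real (\<beta> (r (u i)))) (y (r (u i))))"
        using w_eq by (simp add: w_def X.scale_scale[symmetric] X.scale_of_real del: X.scale_scale)
      also have "norm \<dots> \<le> \<bar>C\<bar> * norm (\<Sum>i<m. smulG (a i * of_real (\<beta> (r (u i)))) (g (s (u i))))"
        by (rule Cu)
      also have "\<dots> \<le> \<bar>C\<bar> * ((\<rho> + 2 * K * D) * A)"
        by (rule mult_left_mono[OF bound]) simp
      finally show "norm (\<Sum>i<m. smulX (a i) ((z \<circ> (\<lambda>i. t (r (u i) + k0))) i)) \<le>
          \<bar>C\<bar> * (\<rho> + 2 * K * D) * norm (\<Sum>i<m. smulG (a i) ((g \<circ> (s \<circ> u)) i))"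
        by (simp only: A_def mult.assoc comp_apply)
    qed
    moreover have "strict_mono (\<lambda>i. t (r (u i) + k0))"
      using mono_w r u(1) by (simp add: strict_mono_def)
    moreover have "\<bar>C\<bar> * (\<rho> + 2 * K * D) \<ge> 0" using 2 K D by simp
    ultimately show ?thesis
      using su by (intro exI[of _ "\<lambda>i. t (r (u i) + k0)"] exI[of _ "s \<circ> u"]
          exI[of _ "\<bar>C\<bar> * (\<rho> + 2 * K * D)"] conjI)
  qed
qed

section \<open>Functionals that are small in the gaps of their prefix\<close>

text \<open>
  Among the prefixes of one infinite sequence at most one satisfies \<open>W\<close> minimally. Thus something
  chosen for the minimal prefix is determined by the infinite sequence and already visible on a
  finite piece of it, as the Ramsey argument requires.
\<close>

definition minimal_prefix :: "(nat list \<Rightarrow> bool) \<Rightarrow> nat list \<Rightarrow> bool" where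
  "minimal_prefix W ps \<longleftrightarrow> W ps \<and> (\<forall>k<length ps. \<not> W (take k ps))"

lemma minimal_prefix_exists:
  assumes "W (map p [0..<m])"
  shows "\<exists>m. minimal_prefix W (map p [0..<m])"
proof -
  define m' where "m' = (LEAST m. W (map p [0..<m]))"
  have "W (map p [0..<m'])" unfolding m'_def using assms by (rule LeastI)
  moreover have "\<not> W (take k (map p [0..<m']))" if "k < m'" for k
    using not_less_Least[of k "\<lambda>m. W (map p [0..<m])"] that by (simp add: m'_def take_map)
  ultimately show ?thesis unfolding minimal_prefix_def by auto
qed

lemma minimal_prefix_unique:
  assumes "minimal_prefix W (map p [0..<m])" and "minimal_prefix W (map p [0..<m'])"
  shows "m = m'"
proof (rule ccontr)
  have *: False if "k < k'" "minimal_prefix W (map p [0..<k])" "minimal_prefix W (map p [0..<k'])" for k k'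
  proof -
    have "take k (map p [0..<k']) = map p [0..<k]" using that(1) by (simp add: take_map)
    then show False using that unfolding minimal_prefix_def by (metis length_map length_upt minus_nat.diff_0)
  qed
  assume "m \<noteq> m'"
  then show False using *[of m m'] *[of m' m] assms by (auto simp: neq_iff)
qed

text \<open>
  The combinatorial heart. Functionals \<open>f n ps\<close> are attached to the minimal prefixes \<open>ps\<close> of
  sequences. After passing to a suitable infinite set \<open>N\<close>, such a functional is tiny at the elements
  of \<open>N\<close> that lie in the gaps of \<open>ps\<close>, provided that \<open>n\<close> does not exceed the first entry of \<open>ps\<close>
  nor \<open>j\<close> the left end of the gap; so only finitely many conditions are imposed on each gap. To see this, read an increasing sequence \<open>l\<close> as a sequence
  \<open>p\<close> at the even places with a marked element in each gap at the odd places, and apply the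
  Nash-Williams dichotomy to the lists on which a functional for the even places is large at a
  marked element. The alternative that every \<open>l\<close> contains such a list is impossible: choose \<open>p\<close>
  first, with gaps containing whole windows from
  the compactness form of weak nullness. The functionals for \<open>p\<close> are now fixed, and each window contains an element at which all relevant ones are small.
\<close>

lemma separated_functionals:
  fixes x :: "nat \<Rightarrow> nat \<Rightarrow> 'a::real_normed_vector"
    and smul :: "'k::{real_normed_field,euclidean_space} \<Rightarrow> 'a \<Rightarrow> 'a"
  assumes sp: "normed_space_over smul" and wn: "\<And>j. weakly_null smul (x j)"
    and f: "\<And>n ps. f n ps \<in> dual_ball smul \<kappa>"
    and W: "\<And>n p. strict_mono p \<Longrightarrow> \<exists>m. W n (map p [0..<m])"
  shows "\<exists>N. infinite N \<and> (\<forall>n l m i j. strict_mono l \<and> range l \<subseteq> N \<and> n \<le> l 0 \<and>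
    minimal_prefix (W n) (map (\<lambda>i. l (2 * i)) [0..<m]) \<and> Suc i < m \<and> j \<le> l (2 * i) \<longrightarrow>
    norm (f n (map (\<lambda>i. l (2 * i)) [0..<m]) (x j (l (2 * i + 1)))) \<le> (1/2) ^ l (2 * i))"
proof -
  define far where "far = (\<lambda>(l :: nat \<Rightarrow> nat) n m i j. n \<le> l 0 \<and>
    minimal_prefix (W n) (map (\<lambda>i. l (2 * i)) [0..<m]) \<and> Suc i < m \<and> j \<le> l (2 * i) \<and>
    \<not> norm (f n (map (\<lambda>i. l (2 * i)) [0..<m]) (x j (l (2 * i + 1)))) \<le> (1/2) ^ l (2 * i))"
  define Q where "Q = (\<lambda>xs. \<exists>n m i j. length xs = 2 * m - 1 \<and> far ((!) xs) n m i j)"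
  \<comment> \<open>whether \<open>l\<close> is bad at \<open>m\<close> only depends on its first \<open>2 * m - 1\<close> values, the last one being \<open>l (2 * (m - 1))\<close>\<close>
  have far_map: "far ((!) (map l [0..<2 * m - 1])) n m i j \<longleftrightarrow> far l n m i j" for l n m i j
  proof (cases "Suc i < m")
    case True
    have "map (\<lambda>i. map l [0..<2 * m - 1] ! (2 * i)) [0..<m] = map (\<lambda>i. l (2 * i)) [0..<m]"
      by (intro map_cong) auto
    moreover have "map l [0..<2 * m - 1] ! 0 = l 0" "map l [0..<2 * m - 1] ! (2 * i) = l (2 * i)"
      "map l [0..<2 * m - 1] ! (2 * i + 1) = l (2 * i + 1)" using True by auto
    ultimately show ?thesis unfolding far_def by (simp only:)
  qed (simp add: far_def)
  obtain N where N: "infinite N" and alt: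
    "(\<forall>l m. strict_mono l \<and> range l \<subseteq> N \<longrightarrow> \<not> Q (map l [0..<m])) \<or>
     (\<forall>l. strict_mono l \<and> range l \<subseteq> N \<longrightarrow> (\<exists>m. Q (map l [0..<m])))"
    using nash_williams_lists[of UNIV Q] by auto
  have "\<not> (\<forall>l. strict_mono l \<and> range l \<subseteq> N \<longrightarrow> (\<exists>m. Q (map l [0..<m])))"
  proof
    assume all: "\<forall>l. strict_mono l \<and> range l \<subseteq> N \<longrightarrow> (\<exists>m. Q (map l [0..<m]))"
    have "\<exists>G\<subseteq>N \<inter> {p<..}. finite G \<and> (\<forall>\<psi>. range \<psi> \<subseteq> dual_ball smul \<kappa> \<longrightarrow>
        (\<exists>q\<in>G. \<forall>n\<le>p. \<forall>j\<le>p. norm (\<psi> n (x j q)) < (1/2) ^ p))" for p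
    proof (rule finite_window[OF sp wn])
      have "N \<inter> {p<..} = {k\<in>N. \<forall>i\<in>{p}. i < k}" by auto
      then show "infinite (N \<inter> {p<..})" using infinite_above[OF N, of "{p}"] by simp
    qed simp
    then obtain G where G: "\<And>p. G p \<subseteq> N \<inter> {p<..}" "\<And>p. finite (G p)"
      and hit: "\<And>p \<psi>. range \<psi> \<subseteq> dual_ball smul \<kappa> \<Longrightarrow>
        \<exists>q\<in>G p. \<forall>n\<le>p. \<forall>j\<le>p. norm (\<psi> n (x j q)) < (1/2) ^ p" by metis
    have "\<exists>p. \<forall>i. p i \<in> N \<and> (p i < p (Suc i) \<and> (\<forall>q\<in>G (p i). q < p (Suc i)))"
    proof (rule dependent_nat_choice)
      show "\<exists>x. x \<in> N" using N by (metis finite.emptyI ex_in_conv)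
      fix y
      have "infinite {k\<in>N. \<forall>i\<in>insert y (G y). i < k}" using G(2) by (intro infinite_above N) simp
      then obtain k where "k \<in> {k\<in>N. \<forall>i\<in>insert y (G y). i < k}" by (metis finite.emptyI ex_in_conv)
      then show "\<exists>k. k \<in> N \<and> (y < k \<and> (\<forall>q\<in>G y. q < k))" by auto
    qed
    then obtain p where pN: "\<And>i. p i \<in> N" and p: "\<And>i. p i < p (Suc i)"
      and Gp: "\<And>i q. q \<in> G (p i) \<Longrightarrow> q < p (Suc i)" by blast
    have sp_p: "strict_mono p" using p by (rule strict_monoI_Suc)
    have "\<exists>m. minimal_prefix (W n) (map p [0..<m])" for n
      using W[OF sp_p, of n] minimal_prefix_exists by blast
    then obtain M where M: "\<And>n. minimal_prefix (W n) (map p [0..<M n])" by metis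
    \<comment> \<open>the finitely many functionals with \<open>n \<le> p i\<close> include those with \<open>n \<le> l 0 = p 0\<close>\<close>
    have "\<exists>q\<in>G (p i). \<forall>n\<le>p i. \<forall>j\<le>p i. norm (f n (map p [0..<M n]) (x j q)) < (1/2) ^ p i" for i
      using hit[of "\<lambda>n. f n (map p [0..<M n])" "p i"] f by blast
    then obtain q where qG: "\<And>i. q i \<in> G (p i)"
      and q: "\<And>i n j. n \<le> p i \<Longrightarrow> j \<le> p i \<Longrightarrow> norm (f n (map p [0..<M n]) (x j (q i))) < (1/2) ^ p i"
      by metis
    define l where "l = (\<lambda>k. if even k then p (k div 2) else q (k div 2))"
    have l: "l (2 * i) = p i" "l (2 * i + 1) = q i" for i by (auto simp: l_def)
    have "strict_mono l"
    proof (rule strict_monoI_Suc)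
      fix k show "l k < l (Suc k)"
        using qG[of "k div 2"] G(1)[of "p (k div 2)"] Gp[of "q (k div 2)" "k div 2"]
        by (cases "even k") (auto simp: l_def)
    qed
    moreover have "range l \<subseteq> N" using pN qG G(1) by (auto simp: l_def)
    ultimately obtain k where "Q (map l [0..<k])" using all by blast
    then obtain n m i j where "k = 2 * m - 1" "far ((!) (map l [0..<k])) n m i j"
      unfolding Q_def by auto
    then have far: "far l n m i j" using far_map by simp
    then have "m = M n" using minimal_prefix_unique[OF _ M] by (simp add: far_def l)
    moreover have "n \<le> p i" using far strict_mono_less_eq[OF sp_p, of 0 i] l(1)[of 0] by (simp add: far_def)
    ultimately show False using far q[of n i j] unfolding far_def l by simp
  qed
  then have no: "\<not> Q (map l [0..<m])" if "strict_mono l" "range l \<subseteq> N" for l m using alt that by blast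
  have "\<not> far l n m i j" if "strict_mono l" "range l \<subseteq> N" for l n m i j
    using no[OF that, of "2 * m - 1"] far_map[of l m n i j] unfolding Q_def by auto
  then show ?thesis using N unfolding far_def by (intro exI[of _ N]) blast
qed

section \<open>Diagonal sums of weakly null sequences\<close>

text \<open>
  Each row tends to 0 under a functional, and the weights make the rows summable uniformly in \<open>k\<close>.
\<close>

lemma weakly_null_weighted_sum:
  fixes x :: "nat \<Rightarrow> nat \<Rightarrow> 'a::real_normed_vector"
    and smul :: "'k::{real_normed_field,euclidean_space} \<Rightarrow> 'a \<Rightarrow> 'a"
  assumes wn: "\<And>j. weakly_null smul (x j)" and bdd: "\<And>j k. norm (x j k) \<le> 1"
    and \<sigma>: "\<And>j. strict_mono (\<sigma> j)"
  shows "weakly_null smul (\<lambda>k. \<Sum>j\<le>k. (1/2) ^ j *\<^sub>R x j (\<sigma> j k))"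
  unfolding weakly_null_def
proof (intro allI impI)
  fix \<phi> :: "'a \<Rightarrow> 'k" assume \<phi>: "bounded_linear \<phi> \<and> (\<forall>c v. \<phi> (smul c v) = c * \<phi> v)"
  then interpret \<phi>: bounded_linear \<phi> by simp
  obtain M where M: "\<And>v. norm (\<phi> v) \<le> norm v * M" "M \<ge> 0" using \<phi>.nonneg_bounded by blast
  define a where "a = (\<lambda>j k. if j \<le> k then (1/2) ^ j *\<^sub>R \<phi> (x j (\<sigma> j k)) else 0)"
  have "(\<lambda>k. a j k) \<longlonglongrightarrow> 0" for j
  proof -
    have "(\<lambda>k. \<phi> (x j k)) \<longlonglongrightarrow> 0" using wn[of j] \<phi> unfolding weakly_null_def by blast
    from LIMSEQ_subseq_LIMSEQ[OF this \<sigma>[of j]]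
    have "(\<lambda>k. (1/2) ^ j *\<^sub>R \<phi> (x j (\<sigma> j k))) \<longlonglongrightarrow> (1/2) ^ j *\<^sub>R 0"
      by (intro tendsto_intros) (simp add: comp_def)
    moreover have "eventually (\<lambda>k. (1/2) ^ j *\<^sub>R \<phi> (x j (\<sigma> j k)) = a j k) sequentially"
      using eventually_ge_at_top[of j] by eventually_elim (simp add: a_def)
    ultimately show ?thesis by (simp add: tendsto_cong)
  qed
  moreover have "norm (a j k) \<le> M * (1/2) ^ j" for j k
  proof -
    have "norm (\<phi> (x j (\<sigma> j k))) \<le> M"
      using M(1)[of "x j (\<sigma> j k)"] mult_right_mono[OF bdd[of j "\<sigma> j k"] M(2)] by simp
    then show ?thesis using M(2) by (simp add: a_def mult.commute mult_left_mono)
  qed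
  ultimately have "(\<lambda>k. \<Sum>j. a j k) \<longlonglongrightarrow> (\<Sum>j. 0 :: 'k)"
    by (intro tannerys_theorem[where M = "\<lambda>j. M * (1/2) ^ j", THEN conjunct2, THEN conjunct2])
      (auto simp: case_prod_unfold)
  moreover have "(\<Sum>j. a j k) = \<phi> (\<Sum>j\<le>k. (1/2) ^ j *\<^sub>R x j (\<sigma> j k))" for k
  proof -
    have "(\<Sum>j. a j k) = (\<Sum>j\<le>k. a j k)" by (rule suminf_finite) (auto simp: a_def)
    also have "\<dots> = \<phi> (\<Sum>j\<le>k. (1/2) ^ j *\<^sub>R x j (\<sigma> j k))"
      by (simp add: a_def \<phi>.sum \<phi>.scaleR)
    finally show ?thesis .
  qed
  ultimately show "(\<lambda>k. \<phi> (\<Sum>j\<le>k. (1/2) ^ j *\<^sub>R x j (\<sigma> j k))) \<longlonglongrightarrow> 0" by simp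
qed

text \<open>
  A functional that norms a combination of the \<open>n\<close>-th row and is tiny at the elements of the other
  rows shows that the rows cannot cancel each other: up to the constant \<open>\<kappa>\<close> and an error governed by
  the coefficients, the same combination of the weighted sums of all rows is as large as the
  contribution of the \<open>n\<close>-th row to it.
\<close>

lemma diagonal_sum_estimate:
  fixes x :: "nat \<Rightarrow> nat \<Rightarrow> 'a::real_normed_vector"
    and smul :: "'k::{real_normed_field,euclidean_space} \<Rightarrow> 'a \<Rightarrow> 'a"
  assumes sp: "normed_space_over smul" and \<phi>: "\<phi> \<in> dual_ball smul \<kappa>"
    and n: "\<And>i. i < m \<Longrightarrow> n \<le> k i"
    and small: "\<And>i j. i < m \<Longrightarrow> j \<le> k i \<Longrightarrow> j \<noteq> n \<Longrightarrow> norm (\<phi> (x j (t j i))) \<le> \<eta> * (1/2) ^ i"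
    and a: "\<And>i. i < m \<Longrightarrow> norm (a i) \<le> A" and "\<eta> \<ge> 0" "A \<ge> 0"
    and norming: "norm (\<Sum>i<m. smul (a i) (x n (t n i))) \<le> norm (\<phi> (\<Sum>i<m. smul (a i) (x n (t n i))))"
  shows "(1/2) ^ n * norm (\<Sum>i<m. smul (a i) (x n (t n i))) \<le>
    \<kappa> * norm (\<Sum>i<m. smul (a i) (\<Sum>j\<le>k i. (1/2) ^ j *\<^sub>R x j (t j i))) + 4 * \<eta> * A"
proof -
  interpret normed_space_over smul by fact
  interpret \<phi>: bounded_linear \<phi> by (rule dual_ball_bounded_linear[OF sp \<phi>])
  have \<phi>_smul: "\<phi> (smul c v) = c * \<phi> v" and \<phi>_bdd: "norm (\<phi> v) \<le> \<kappa> * norm v" for c v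
    using \<phi> by (auto simp: dual_ball_def)
  have smul_scaleR: "smul c (r *\<^sub>R v) = r *\<^sub>R smul c v" for c r v
    by (metis scale_of_real scale_left_commute)
  define w where "w = (\<Sum>i<m. smul (a i) (x n (t n i)))"
  define y where "y = (\<lambda>i. \<Sum>j\<in>{..k i} - {n}. (1/2) ^ j *\<^sub>R x j (t j i))"
  have y_small: "norm (\<phi> (y i)) \<le> 2 * \<eta> * (1/2) ^ i" if i: "i < m" for i
  proof -
    have "norm (\<phi> (y i)) \<le> (\<Sum>j\<in>{..k i} - {n}. (1/2) ^ j * (\<eta> * (1/2) ^ i))"
      unfolding y_def \<phi>.sum \<phi>.scaleR
      using small[OF i] by (intro sum_norm_le) (auto intro: mult_left_mono)
    also have "\<dots> \<le> (\<Sum>j<Suc (k i). (1/2) ^ j * (\<eta> * (1/2) ^ i))"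
      using \<open>\<eta> \<ge> 0\<close> by (intro sum_mono2) auto
    also have "\<dots> \<le> 2 * (\<eta> * (1/2) ^ i)"
      unfolding sum_distrib_right[symmetric]
      using \<open>\<eta> \<ge> 0\<close> by (intro mult_right_mono sum_half_powers_le) auto
    finally show ?thesis by simp
  qed
  have split: "(\<Sum>j\<le>k i. (1/2) ^ j *\<^sub>R x j (t j i)) = (1/2) ^ n *\<^sub>R x n (t n i) + y i" if "i < m" for i
    unfolding y_def using n[OF that] by (intro sum.remove) auto
  have "(\<Sum>i<m. smul (a i) (\<Sum>j\<le>k i. (1/2) ^ j *\<^sub>R x j (t j i))) =
      (1/2) ^ n *\<^sub>R w + (\<Sum>i<m. smul (a i) (y i))"
  proof -
    have "smul (a i) (\<Sum>j\<le>k i. (1/2) ^ j *\<^sub>R x j (t j i)) =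
        (1/2) ^ n *\<^sub>R smul (a i) (x n (t n i)) + smul (a i) (y i)" if "i < m" for i
      unfolding split[OF that] scale_right_distrib smul_scaleR ..
    then show ?thesis by (simp add: w_def sum.distrib scaleR_sum_right)
  qed
  then have "(1/2) ^ n *\<^sub>R \<phi> w =
      \<phi> (\<Sum>i<m. smul (a i) (\<Sum>j\<le>k i. (1/2) ^ j *\<^sub>R x j (t j i))) - \<phi> (\<Sum>i<m. smul (a i) (y i))"
    by (simp add: \<phi>.add \<phi>.scaleR)
  then have "(1/2) ^ n * norm (\<phi> w) = norm
      (\<phi> (\<Sum>i<m. smul (a i) (\<Sum>j\<le>k i. (1/2) ^ j *\<^sub>R x j (t j i))) - \<phi> (\<Sum>i<m. smul (a i) (y i)))"
    by (metis norm_scaleR abs_of_nonneg zero_le_power zero_le_divide_1_iff zero_le_numeral)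
  also have "\<dots> \<le> norm (\<phi> (\<Sum>i<m. smul (a i) (\<Sum>j\<le>k i. (1/2) ^ j *\<^sub>R x j (t j i)))) +
      norm (\<phi> (\<Sum>i<m. smul (a i) (y i)))" by (rule norm_triangle_ineq4)
  also have "\<dots> \<le> \<kappa> * norm (\<Sum>i<m. smul (a i) (\<Sum>j\<le>k i. (1/2) ^ j *\<^sub>R x j (t j i))) + 4 * \<eta> * A"
  proof (rule add_mono[OF \<phi>_bdd])
    have "norm (\<phi> (\<Sum>i<m. smul (a i) (y i))) \<le> (\<Sum>i<m. A * (2 * \<eta> * (1/2) ^ i))"
      unfolding \<phi>.sum \<phi>_smul
      using a y_small \<open>A \<ge> 0\<close> by (intro sum_norm_le) (simp add: norm_mult mult_mono)
    also have "\<dots> = A * (2 * \<eta>) * (\<Sum>i<m. (1/2) ^ i)" by (simp add: sum_distrib_left mult.assoc)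
    also have "\<dots> \<le> A * (2 * \<eta>) * 2"
      using \<open>A \<ge> 0\<close> \<open>\<eta> \<ge> 0\<close> by (intro mult_left_mono sum_half_powers_le) auto
    finally show "norm (\<phi> (\<Sum>i<m. smul (a i) (y i))) \<le> 4 * \<eta> * A" by (simp add: ac_simps)
  qed
  finally have "(1/2) ^ n * norm (\<phi> w) \<le>
      \<kappa> * norm (\<Sum>i<m. smul (a i) (\<Sum>j\<le>k i. (1/2) ^ j *\<^sub>R x j (t j i))) + 4 * \<eta> * A" .
  moreover have "(1/2) ^ n * norm w \<le> (1/2) ^ n * norm (\<phi> w)"
    using norming by (intro mult_left_mono) (simp_all add: w_def)
  ultimately show ?thesis unfolding w_def by linarith
qed


text \<open>
  The weighted sums \<open>z k\<close> use elements of \<open>N\<close> from the block of positions \<open>k\<^sup>2\<close>, ..., \<open>k\<^sup>2 + k\<close>,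
  so that the elements of the different rows interleave: those of the other rows lie in the gaps of
  those of the \<open>n\<close>-th row.
\<close>

theorem corollary1p4:
  fixes smulG :: "'k::{real_normed_field,euclidean_space} \<Rightarrow> 'g::banach \<Rightarrow> 'g"
    and smulX :: "'k \<Rightarrow> 'x::banach \<Rightarrow> 'x"
    and g :: "nat \<Rightarrow> 'g"
  assumes "normed_space_over smulG" and "normed_space_over smulX"
    and "schauder_basis smulG g" and "seminormalized g" and "right_dominant smulG g"
    and "\<And>x :: nat \<Rightarrow> 'x. normalized x \<Longrightarrow> weakly_null smulX x \<Longrightarrow>
      \<exists>r s. strict_mono r \<and> strict_mono s \<and> dominates smulG (g \<circ> s) smulX (x \<circ> r)"
  shows "\<exists>C>0. \<forall>x :: nat \<Rightarrow> 'x. normalized x \<and> weakly_null smulX x \<longrightarrow>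
      (\<exists>r s. strict_mono r \<and> strict_mono s \<and> C_dominates C smulG (g \<circ> s) smulX (x \<circ> r))"
proof (rule ccontr)
  note spG = assms(1) and spX = assms(2) and hyp = assms(6)
  assume neg: "\<not> ?thesis"
  have "\<exists>x :: nat \<Rightarrow> 'x. normalized x \<and> weakly_null smulX x \<and>
      (\<forall>r s. strict_mono r \<longrightarrow> strict_mono s \<longrightarrow> \<not> C_dominates (4 ^ n) smulG (g \<circ> s) smulX (x \<circ> r))" for n
  proof -
    have "(4::real) ^ n > 0" by simp
    then show ?thesis using neg by blast
  qed
  then obtain x :: "nat \<Rightarrow> nat \<Rightarrow> 'x" where norm_x: "\<And>n. normalized (x n)"
    and wn: "\<And>n. weakly_null smulX (x n)"
    and bad: "\<And>n r s. strict_mono r \<Longrightarrow> strict_mono s \<Longrightarrow>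
      \<not> C_dominates (4 ^ n) smulG (g \<circ> s) smulX (x n \<circ> r)" by metis
  have norm_x1: "norm (x j k) = 1" for j k using norm_x by (simp add: normalized_def)
  obtain K where K: "K > 0" and coeff: "\<And>(l :: nat \<Rightarrow> nat) a m i. strict_mono l \<Longrightarrow> i < m \<Longrightarrow>
      norm (a i) \<le> K * norm (\<Sum>i<m. smulG (a i) (g (l i)))"
    using schauder_coefficients_bounded[OF spG assms(3,4)] by blast
  obtain D where D: "\<And>n. norm (g n) \<le> D" using assms(4) unfolding seminormalized_def by blast
  obtain N0 B where B: "\<And>m l :: nat \<Rightarrow> nat. strict_mono m \<Longrightarrow> strict_mono l \<Longrightarrow> (\<And>n. m n \<le> l n) \<Longrightarrow>
      N0 \<le> m 0 \<Longrightarrow> C_dominates B smulG (g \<circ> l) smulG (g \<circ> m)"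
    using uniform_right_dominance[OF spG assms(5)] by blast
  obtain \<kappa> where \<kappa>: "\<kappa> > 0" and norming: "\<And>w :: 'x. \<exists>\<phi>\<in>dual_ball smulX \<kappa>. norm w \<le> norm (\<phi> w)"
    using norming_functional[OF spX] by blast
  \<comment> \<open>A row is compared with the basis at the next index: a given dominating subsequence of the
    basis can be overtaken by thinning out, and right dominance then replaces it by these vectors.
    So the last entry of \<open>ps\<close> only serves as an index of the basis, whence \<open>length ps - 1\<close>.\<close>
  define vec where "vec = (\<lambda>n ps a. \<Sum>i<length ps - 1. smulX (a i) (x n (ps ! i)))"
  define ref where "ref = (\<lambda>ps a. \<Sum>i<length ps - 1. smulG (a i) (g (ps ! Suc i)))"
  define W where "W = (\<lambda>n ps. \<exists>a. 4 ^ n * norm (ref ps a) < norm (vec n ps a))"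
  define A where "A = (\<lambda>n ps. SOME a. 4 ^ n * norm (ref ps a) < norm (vec n ps a))"
  have A: "4 ^ n * norm (ref ps (A n ps)) < norm (vec n ps (A n ps))" if "W n ps" for n ps
    using that unfolding W_def A_def by (rule someI_ex)
  obtain F where F: "\<And>w :: 'x. F w \<in> dual_ball smulX \<kappa> \<and> norm w \<le> norm (F w w)"
    using norming by metis
  define f where "f = (\<lambda>n ps. F (vec n ps (A n ps)))"
  have f: "f n ps \<in> dual_ball smulX \<kappa>" for n ps using F by (simp add: f_def)
  have W_ex: "\<exists>m. W n (map p [0..<m])" if p: "strict_mono p" for n p
  proof -
    have "strict_mono (p \<circ> Suc)" using p by (simp add: strict_mono_def)
    from bad[OF p this, of n] obtain a m where
      "4 ^ n * norm (\<Sum>i<m. smulG (a i) (g (p (Suc i)))) < norm (\<Sum>i<m. smulX (a i) (x n (p i)))"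
      unfolding C_dominates_iff_initial[OF spG spX] by (auto simp: not_le)
    moreover have "ref (map p [0..<Suc m]) a = (\<Sum>i<m. smulG (a i) (g (p (Suc i))))"
      unfolding ref_def by (intro sum.cong) (auto simp del: upt_Suc)
    moreover have "vec n (map p [0..<Suc m]) a = (\<Sum>i<m. smulX (a i) (x n (p i)))"
      unfolding vec_def by (intro sum.cong) (auto simp del: upt_Suc)
    ultimately show ?thesis unfolding W_def by metis
  qed
  have "\<exists>N. infinite N \<and> (\<forall>n l m i j. strict_mono l \<and> range l \<subseteq> N \<and> n \<le> l 0 \<and>
      minimal_prefix (W n) (map (\<lambda>i. l (2 * i)) [0..<m]) \<and> Suc i < m \<and> j \<le> l (2 * i) \<longrightarrow>
      norm (f n (map (\<lambda>i. l (2 * i)) [0..<m]) (x j (l (2 * i + 1)))) \<le> (1/2) ^ l (2 * i))"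
    by (rule separated_functionals[OF spX wn f W_ex])
  then obtain N where N: "infinite N" and sep: "\<forall>n l m i j. strict_mono l \<and> range l \<subseteq> N \<and> n \<le> l 0 \<and>
      minimal_prefix (W n) (map (\<lambda>i. l (2 * i)) [0..<m]) \<and> Suc i < m \<and> j \<le> l (2 * i) \<longrightarrow>
      norm (f n (map (\<lambda>i. l (2 * i)) [0..<m]) (x j (l (2 * i + 1)))) \<le> (1/2) ^ l (2 * i)"
    by (elim exE conjE)
  define e where "e = enumerate N"
  have e: "strict_mono e" and eN: "\<And>k. e k \<in> N"
    using N by (auto simp: e_def strict_mono_enumerate enumerate_in_set)
  have e_ge: "k \<le> e k" for k using e by (rule strict_mono_imp_increasing)
  define z where "z = (\<lambda>k. \<Sum>j\<le>k. (1/2) ^ j *\<^sub>R x j (e (k\<^sup>2 + j)))"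
  have "weakly_null smulX z"
    unfolding z_def
  proof (rule weakly_null_weighted_sum[OF wn])
    show "strict_mono (\<lambda>k. e (k\<^sup>2 + j))" for j
      using e by (intro strict_monoI_Suc) (auto simp: strict_mono_less power2_eq_square)
  qed (simp add: norm_x1)
  moreover have "norm (z k) \<le> 2" for k
  proof -
    have "norm (z k) \<le> (\<Sum>j\<le>k. (1/2) ^ j)" unfolding z_def by (intro sum_norm_le) (simp add: norm_x1)
    also have "\<dots> \<le> 2" using sum_half_powers_le[of "Suc k"] by (simp only: lessThan_Suc_atMost)
    finally show ?thesis .
  qed
  ultimately obtain r s C where r: "strict_mono r" and s: "strict_mono s" and "C \<ge> 0"
    and dom: "C_dominates C smulG (g \<circ> s) smulX (z \<circ> r)"
    using bounded_weakly_null_dominated[OF spG spX coeff less_imp_le[OF K] D hyp] by blast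
  \<comment> \<open>all constants that do not depend on the row are collected in \<open>R\<close>; row \<open>n\<close> beats it for large \<open>n\<close>\<close>
  define R where "R = \<kappa> * (C * \<bar>B\<bar>) + 8 * (\<kappa> + 1) * K"
  obtain n where n: "R < 2 ^ n" using real_arch_pow[of 2 R] by auto
  \<comment> \<open>growing so fast that the dominating index \<open>s (u i)\<close> lies below the next row index \<open>p (Suc i)\<close>\<close>
  define u where "u = rec_nat (max (Suc n) N0) (\<lambda>_ v. Suc (s v))"
  have u0: "u 0 = max (Suc n) N0" and u_Suc: "u (Suc i) = Suc (s (u i))" for i by (simp_all add: u_def)
  have s_ge: "i \<le> s i" and r_ge: "i \<le> r i" for i using s r by (auto intro: strict_mono_imp_increasing)
  have u: "strict_mono u" by (rule strict_monoI_Suc) (simp add: u_Suc s_ge le_imp_less_Suc)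
  define k where "k = (\<lambda>i. r (u i))"
  have k: "strict_mono k" using r u by (simp add: k_def strict_mono_def)
  have k_n: "Suc n \<le> k i" for i
  proof -
    have "Suc n \<le> u 0" by (simp add: u0)
    also have "\<dots> \<le> u i" using u by (simp add: strict_mono_less_eq)
    also have "\<dots> \<le> k i" by (simp add: k_def r_ge)
    finally show ?thesis .
  qed
  have k_sq: "(k i)\<^sup>2 + 2 * k i < (k (Suc i))\<^sup>2" for i
  proof -
    have "Suc (k i) \<le> k (Suc i)" using k by (simp add: strict_mono_less Suc_le_eq)
    then have "(Suc (k i))\<^sup>2 \<le> (k (Suc i))\<^sup>2" by (rule power_mono) simp
    then show ?thesis by (simp add: power2_eq_square)
  qed
  define p where "p = (\<lambda>i. e ((k i)\<^sup>2 + n))"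
  have p: "strict_mono p"
    unfolding p_def using k_sq by (intro strict_monoI_Suc) (auto simp: strict_mono_less[OF e] intro: le_less_trans[OF le_add1])
  have p_k: "k i \<le> p i" for i
  proof -
    have "k i \<le> (k i)\<^sup>2 + n" by (simp add: power2_eq_square trans_le_add1)
    then show ?thesis unfolding p_def using e_ge order_trans by blast
  qed
  obtain m where m: "minimal_prefix (W n) (map p [0..<m])"
    using W_ex[OF p] minimal_prefix_exists by blast
  define ps where "ps = map p [0..<m]"
  define a where "a = A n ps"
  define \<phi> where "\<phi> = f n ps"
  have vec: "vec n ps a = (\<Sum>i<m - 1. smulX (a i) (x n (p i)))"
    unfolding vec_def ps_def by (intro sum.cong) auto
  have ref: "ref ps a = (\<Sum>i<m - 1. smulG (a i) (g (p (Suc i))))"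
    unfolding ref_def ps_def by (intro sum.cong) auto
  define \<gamma> where "\<gamma> = norm (\<Sum>i<m - 1. smulG (a i) (g (p (Suc i))))"
  have large: "4 ^ n * \<gamma> < norm (\<Sum>i<m - 1. smulX (a i) (x n (p i)))"
    using A[of n ps] m by (simp add: minimal_prefix_def ps_def[symmetric] a_def[symmetric] vec ref \<gamma>_def)
  \<comment> \<open>each gap of \<open>p\<close> contains the position \<open>(k i)\<^sup>2 + n + 1\<close>; in the \<open>i\<close>-th gap mark \<open>t\<close> instead\<close>
  have gap: "norm (\<phi> (x j (e t))) \<le> (1/2) ^ p i"
    if i: "i < m - 1" and t: "(k i)\<^sup>2 + n < t" "t < (k (Suc i))\<^sup>2 + n" and j: "j \<le> p i" for i j t
  proof -
    define q where "q = (\<lambda>i'. if i' = i then t else (k i')\<^sup>2 + n + 1)"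
    have q: "(k i')\<^sup>2 + n < q i'" "q i' < (k (Suc i'))\<^sup>2 + n" for i'
    proof -
      have "(k i')\<^sup>2 + n + 1 < (k (Suc i'))\<^sup>2 + n" using k_sq[of i'] k_n[of i'] by linarith
      then show "(k i')\<^sup>2 + n < q i'" "q i' < (k (Suc i'))\<^sup>2 + n" using t by (auto simp: q_def)
    qed
    define l where "l = (\<lambda>k. if even k then p (k div 2) else e (q (k div 2)))"
    have l: "l (2 * i') = p i'" "l (2 * i' + 1) = e (q i')" for i' by (auto simp: l_def)
    have "strict_mono l"
    proof (rule strict_monoI_Suc)
      fix c show "l c < l (Suc c)"
        using q[of "c div 2"] by (cases "even c") (auto simp: l_def p_def strict_mono_less[OF e])
    qed
    moreover have "range l \<subseteq> N" using eN by (auto simp: l_def p_def)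
    moreover have "n \<le> l 0" using l(1)[of 0] k_n[of 0] p_k[of 0] by simp
    ultimately show ?thesis using sep[rule_format, of l n m i j] m i j by (simp add: l \<phi>_def ps_def q_def del: One_nat_def)
  qed
  have small: "norm (\<phi> (x j (e ((k i)\<^sup>2 + j)))) \<le> 2 * (\<kappa> + 1) * (1/2) ^ i"
    if i: "i < m - 1" and j: "j \<le> k i" "j \<noteq> n" for i j
  proof -
    have i_p: "i \<le> p i" for i using p by (rule strict_mono_imp_increasing)
    have pow: "(1/2 :: real) ^ p i \<le> (1/2) ^ i" for i using i_p by (intro power_decreasing) auto
    \<comment> \<open>rows \<open>j > n\<close> lie in the gap after \<open>p i\<close>, rows \<open>j < n\<close> in the one before \<open>p i\<close>; for \<open>i = 0\<close> the
      latter is no gap, and the trivial bound is used once\<close>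
    consider "n < j" | "j < n" "i = 0" | i0 where "j < n" "i = Suc i0"
      using j(2) by (cases i) (auto simp: neq_iff)
    then show ?thesis
    proof cases
      case 1
      have "norm (\<phi> (x j (e ((k i)\<^sup>2 + j)))) \<le> (1/2) ^ p i"
        using 1 j(1) k_sq[of i] p_k[of i] by (intro gap i) linarith+
      also have "\<dots> \<le> 1 * (1/2) ^ i" using pow by simp
      also have "\<dots> \<le> 2 * (\<kappa> + 1) * (1/2) ^ i" using \<kappa> by (intro mult_right_mono) auto
      finally show ?thesis .
    next
      case 2
      have "norm (\<phi> (x j (e ((k i)\<^sup>2 + j)))) \<le> \<kappa> * norm (x j (e ((k i)\<^sup>2 + j)))"
        using f[of n ps] by (simp add: dual_ball_def \<phi>_def)
      then show ?thesis using 2 \<kappa> by (simp add: norm_x1)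
    next
      case 3
      have "norm (\<phi> (x j (e ((k i)\<^sup>2 + j)))) \<le> (1/2) ^ p i0"
      proof (rule gap)
        show "i0 < m - 1" using 3 i by simp
        show "(k i0)\<^sup>2 + n < (k i)\<^sup>2 + j" using k_sq[of i0] k_n[of i0] 3 by simp
        show "(k i)\<^sup>2 + j < (k (Suc i0))\<^sup>2 + n" using 3 by simp
        show "j \<le> p i0" using 3 k_n[of i0] p_k[of i0] by linarith
      qed
      also have "\<dots> \<le> (1/2) ^ i0" by (rule pow)
      also have "\<dots> = 2 * (1/2) ^ i" using 3 by simp
      also have "\<dots> \<le> 2 * (\<kappa> + 1) * (1/2) ^ i" using \<kappa> by (intro mult_right_mono) auto
      finally show ?thesis .
    qed
  qed
  have p_Suc: "strict_mono (p \<circ> Suc)" using p by (simp add: strict_mono_def)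
  have "(1/2) ^ n * norm (\<Sum>i<m - 1. smulX (a i) (x n (e ((k i)\<^sup>2 + n)))) \<le>
      \<kappa> * norm (\<Sum>i<m - 1. smulX (a i) (\<Sum>j\<le>k i. (1/2) ^ j *\<^sub>R x j (e ((k i)\<^sup>2 + j)))) +
      4 * (2 * (\<kappa> + 1)) * (K * \<gamma>)"
  proof (rule diagonal_sum_estimate[OF spX, where \<phi> = \<phi>])
    show "\<phi> \<in> dual_ball smulX \<kappa>" using f by (simp add: \<phi>_def)
    show "n \<le> k i" for i using k_n[of i] by simp
    show "norm (a i) \<le> K * \<gamma>" if "i < m - 1" for i
      using coeff[OF p_Suc that, of a] by (simp add: \<gamma>_def)
    show "norm (\<Sum>i<m - 1. smulX (a i) (x n (e ((k i)\<^sup>2 + n)))) \<le>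
        norm (\<phi> (\<Sum>i<m - 1. smulX (a i) (x n (e ((k i)\<^sup>2 + n)))))"
      using F[of "vec n ps a"] vec by (simp add: \<phi>_def f_def a_def[symmetric] p_def)
    show "0 \<le> K * \<gamma>" using K by (simp add: \<gamma>_def)
  qed (use small \<kappa> in auto)
  also have "(\<Sum>i<m - 1. smulX (a i) (\<Sum>j\<le>k i. (1/2) ^ j *\<^sub>R x j (e ((k i)\<^sup>2 + j)))) =
      (\<Sum>i<m - 1. smulX (a i) (z (r (u i))))" by (simp add: z_def k_def)
  finally have lower: "(1/2) ^ n * norm (\<Sum>i<m - 1. smulX (a i) (x n (p i))) \<le>
      \<kappa> * norm (\<Sum>i<m - 1. smulX (a i) (z (r (u i)))) + 8 * (\<kappa> + 1) * K * \<gamma>"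
    by (simp add: p_def mult.assoc)
  have "norm (\<Sum>i<m - 1. smulX (a i) (z (r (u i)))) \<le> C * norm (\<Sum>i<m - 1. smulG (a i) (g (s (u i))))"
    using C_dominates_subseq[OF dom u] unfolding C_dominates_iff_initial[OF spG spX] by simp
  also have "\<dots> \<le> C * (\<bar>B\<bar> * \<gamma>)"
  proof (rule mult_left_mono[OF _ \<open>C \<ge> 0\<close>])
    have "C_dominates B smulG (g \<circ> (p \<circ> Suc)) smulG (g \<circ> (s \<circ> u))"
    proof (rule B)
      show "strict_mono (s \<circ> u)" using s u by (simp add: strict_mono_def)
      show "strict_mono (p \<circ> Suc)" by fact
      show "(s \<circ> u) i \<le> (p \<circ> Suc) i" for i
      proof -
        have "s (u i) \<le> u (Suc i)" by (simp add: u_Suc)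
        also have "\<dots> \<le> k (Suc i)" by (simp add: k_def r_ge)
        also have "\<dots> \<le> p (Suc i)" by (rule p_k)
        finally show ?thesis by simp
      qed
      show "N0 \<le> (s \<circ> u) 0" using s_ge[of "u 0"] by (simp add: u0)
    qed
    then have "norm (\<Sum>i<m - 1. smulG (a i) (g (s (u i)))) \<le> B * \<gamma>"
      unfolding C_dominates_iff_initial[OF spG spG] by (simp add: \<gamma>_def)
    also have "\<dots> \<le> \<bar>B\<bar> * \<gamma>" by (intro mult_right_mono) (auto simp: \<gamma>_def)
    finally show "norm (\<Sum>i<m - 1. smulG (a i) (g (s (u i)))) \<le> \<bar>B\<bar> * \<gamma>" .
  qed
  finally have upper: "norm (\<Sum>i<m - 1. smulX (a i) (z (r (u i)))) \<le> C * \<bar>B\<bar> * \<gamma>" by (simp add: mult.assoc)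
  have "2 ^ n * \<gamma> = (1/2) ^ n * (4 ^ n * \<gamma>)"
    by (simp flip: power_mult_distrib mult.assoc)
  also have "\<dots> < (1/2) ^ n * norm (\<Sum>i<m - 1. smulX (a i) (x n (p i)))"
    using large by (intro mult_strict_left_mono) auto
  also have "\<dots> \<le> \<kappa> * (C * \<bar>B\<bar> * \<gamma>) + 8 * (\<kappa> + 1) * K * \<gamma>"
    using lower mult_left_mono[OF upper, of \<kappa>] \<kappa> by linarith
  also have "\<dots> = R * \<gamma>" by (simp add: R_def algebra_simps)
  also have "\<dots> \<le> 2 ^ n * \<gamma>" using n by (intro mult_right_mono) (auto simp: \<gamma>_def)
  finally show False by simp
qed

end
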